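(* Let $g\in L^2(\mathbb{R}^d)$ satisfy the admissibility condition $$\int_{\mathbb{R}^+}|\hat g(t\omega)|^2\,\frac{dt}{t}=1\quad\text{for all }\omega\in\mathbb{R}^d\setminus\{0\}.$$ A closed and bounded set $S\subseteq L^2(\mathbb{R}^d)$ is compact in $L^2(\mathbb{R}^d)$ if and only if for every $\epsilon>0$ there exists a compact set $U\subseteq\mathbb{R}^d\times\mathbb{R}^+$ such that $$\sup_{f\in S}\Big(\int_{U^c}|\mathcal{W}_g f(x,s)|^2\,\frac{dx\,ds}{s^{d+1}}\Big)^{1/2}<\epsilon .$$
   Context: $\mathbb{R}^+=(0,\infty)$, and $\hat g$ is the Fourier transform of $g$, normalized as $\hat g(\omega)=\int_{\mathbb{R}^d} g(t)e^{-2\pi i\omega\cdot t}\,dt$ (extended to $L^2$). For $(x,s)\in\mathbb{R}^d\times\mathbb{R}^+$ let $T_xD_s g(t)=s^{-d/2}g(s^{-1}(t-x))$. The continuous wavelet transform of $f\in L^2(\mathbb{R}^d)$ with respect to $g$ is $$\mathcal{W}_g f(x,s)=\langle f,T_xD_s g\rangle=s^{-d/2}\int_{\mathbb{R}^d}f(t)\,\overline{g\big(\tfrac{t-x}{s}\big)}\,dt .$$ $U^c$ denotes the complement of $U$ in $\mathbb{R}^d\times\mathbb{R}^+$; compactness of $U$ is in the topology of $\mathbb{R}^d\times(0,\infty)$. *)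

theory Defs
  imports "HOL-Analysis.Analysis"
begin

definition square_integrable :: "(real^'d::finite \<Rightarrow> complex) \<Rightarrow> bool" where
  "square_integrable f \<longleftrightarrow>
     f \<in> borel_measurable lborel \<and> integrable lborel (\<lambda>t. (cmod (f t))\<^sup>2)"

lemma square_integrable_measurable [dest]:
  "square_integrable f \<Longrightarrow> f \<in> borel_measurable borel"
  by (simp add: square_integrable_def)

lemma square_integrable_zero: "square_integrable (\<lambda>_. 0)"
  by (simp add: square_integrable_def)

lemma square_integrable_cmult:
  assumes "square_integrable f"
  shows "square_integrable (\<lambda>t. c * f t)"
  using assms by (auto simp: square_integrable_def norm_mult power_mult_distrib)

lemma square_integrable_add:
  assumes f: "square_integrable f" and g: "square_integrable g"
  shows "square_integrable (\<lambda>t. f t + g t)"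
proof -
  have m[measurable]: "f \<in> borel_measurable borel" "g \<in> borel_measurable borel"
    using f g by auto
  have "integrable lborel (\<lambda>t. (cmod (f t + g t))\<^sup>2)"
  proof (rule Bochner_Integration.integrable_bound)
    show "integrable lborel (\<lambda>t. 2 * (cmod (f t))\<^sup>2 + 2 * (cmod (g t))\<^sup>2)"
      using f g by (simp add: square_integrable_def)
    have "(cmod (f t + g t))\<^sup>2 \<le> 2 * (cmod (f t))\<^sup>2 + 2 * (cmod (g t))\<^sup>2" for t
    proof -
      have "(cmod (f t + g t))\<^sup>2 \<le> (cmod (f t) + cmod (g t))\<^sup>2"
        by (intro power_mono norm_triangle_ineq) auto
      also have "\<dots> \<le> 2 * (cmod (f t))\<^sup>2 + 2 * (cmod (g t))\<^sup>2"
        using sum_squares_bound[of "cmod (f t)" "cmod (g t)"]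
        by (simp add: power2_sum)
      finally show ?thesis .
    qed
    then show "AE t in lborel. norm ((cmod (f t + g t))\<^sup>2)
        \<le> norm (2 * (cmod (f t))\<^sup>2 + 2 * (cmod (g t))\<^sup>2)"
      by simp
  qed measurable
  then show ?thesis
    by (simp add: square_integrable_def)
qed

lemma borel_measurable_cnj [measurable]: "cnj \<in> borel_measurable borel"
  by (intro borel_measurable_continuous_onI continuous_intros)

lemma square_integrable_mult_cnj:
  assumes f: "square_integrable f" and g: "square_integrable g"
  shows "integrable lborel (\<lambda>t. f t * cnj (g t))"
proof (rule Bochner_Integration.integrable_bound)
  have m[measurable]: "f \<in> borel_measurable borel" "g \<in> borel_measurable borel"
    using f g by auto
  show "integrable lborel (\<lambda>t. (cmod (f t))\<^sup>2 + (cmod (g t))\<^sup>2)"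
    using f g by (simp add: square_integrable_def)
  show "(\<lambda>t. f t * cnj (g t)) \<in> borel_measurable lborel"
    by measurable
  have "cmod (f t) * cmod (g t) \<le> (cmod (f t))\<^sup>2 + (cmod (g t))\<^sup>2" for t
    using sum_squares_bound[of "cmod (f t)" "cmod (g t)"]
      mult_nonneg_nonneg[OF norm_ge_zero[of "f t"] norm_ge_zero[of "g t"]] by linarith
  then show "AE t in lborel. norm (f t * cnj (g t))
      \<le> norm ((cmod (f t))\<^sup>2 + (cmod (g t))\<^sup>2)"
    by (simp add: norm_mult)
qed

lemma Minkowski_square_integrable:
  assumes f: "square_integrable f" and g: "square_integrable g"
  shows "sqrt (\<integral>t. (cmod (f t + g t))\<^sup>2 \<partial>lborel)
    \<le> sqrt (\<integral>t. (cmod (f t))\<^sup>2 \<partial>lborel) + sqrt (\<integral>t. (cmod (g t))\<^sup>2 \<partial>lborel)"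
proof -
  have m[measurable]: "f \<in> borel_measurable borel" "g \<in> borel_measurable borel"
    using f g by auto
  have f2: "integrable lborel (\<lambda>t. (cmod (f t))\<^sup>2)" and g2: "integrable lborel (\<lambda>t. (cmod (g t))\<^sup>2)"
    using f g by (auto simp: square_integrable_def)
  have fg: "integrable lborel (\<lambda>t. cmod (f t) * cmod (g t))"
    using integrable_norm[OF square_integrable_mult_cnj[OF f g]] by (simp add: norm_mult)
  define a where "a = (\<integral>t. (cmod (f t))\<^sup>2 \<partial>lborel)"
  define b where "b = (\<integral>t. (cmod (g t))\<^sup>2 \<partial>lborel)"
  define c where "c = (\<integral>t. cmod (f t) * cmod (g t) \<partial>lborel)"
  have nn: "a \<ge> 0" "b \<ge> 0" "c \<ge> 0"
    by (simp_all add: a_def b_def c_def)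
  have "(\<integral>\<^sup>+t. ennreal (cmod (f t)) * ennreal (cmod (g t)) \<partial>lborel)\<^sup>2
      \<le> (\<integral>\<^sup>+t. (ennreal (cmod (f t)))\<^sup>2 \<partial>lborel) * (\<integral>\<^sup>+t. (ennreal (cmod (g t)))\<^sup>2 \<partial>lborel)"
    by (rule Cauchy_Schwarz_nn_integral) measurable
  moreover have "(\<integral>\<^sup>+t. ennreal (cmod (f t)) * ennreal (cmod (g t)) \<partial>lborel) = ennreal c"
    using nn_integral_eq_integral[OF fg] by (simp add: c_def ennreal_mult)
  moreover have "(\<integral>\<^sup>+t. (ennreal (cmod (f t)))\<^sup>2 \<partial>lborel) = ennreal a"
    using nn_integral_eq_integral[OF f2] by (simp add: a_def ennreal_power)
  moreover have "(\<integral>\<^sup>+t. (ennreal (cmod (g t)))\<^sup>2 \<partial>lborel) = ennreal b"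
    using nn_integral_eq_integral[OF g2] by (simp add: b_def ennreal_power)
  ultimately have "ennreal (c\<^sup>2) \<le> ennreal (a * b)"
    using nn by (simp add: ennreal_power ennreal_mult)
  then have "c\<^sup>2 \<le> a * b"
    using nn by (simp add: ennreal_le_iff)
  then have c: "c \<le> sqrt a * sqrt b"
    using real_le_rsqrt real_sqrt_mult by metis
  have "(\<integral>t. (cmod (f t + g t))\<^sup>2 \<partial>lborel)
      \<le> (\<integral>t. (cmod (f t))\<^sup>2 + 2 * (cmod (f t) * cmod (g t)) + (cmod (g t))\<^sup>2 \<partial>lborel)"
  proof (rule integral_mono)
    show "integrable lborel (\<lambda>t. (cmod (f t + g t))\<^sup>2)"
      using square_integrable_add[OF f g] by (simp add: square_integrable_def)
    show "integrable lborel (\<lambda>t. (cmod (f t))\<^sup>2 + 2 * (cmod (f t) * cmod (g t)) + (cmod (g t))\<^sup>2)"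
      using f2 g2 fg by auto
    fix t
    have "(cmod (f t + g t))\<^sup>2 \<le> (cmod (f t) + cmod (g t))\<^sup>2"
      by (intro power_mono norm_triangle_ineq) auto
    then show "(cmod (f t + g t))\<^sup>2
        \<le> (cmod (f t))\<^sup>2 + 2 * (cmod (f t) * cmod (g t)) + (cmod (g t))\<^sup>2"
      by (simp add: power2_sum)
  qed
  also have "\<dots> = a + 2 * c + b"
    using f2 g2 fg by (simp add: a_def b_def c_def)
  also have "\<dots> \<le> (sqrt a + sqrt b)\<^sup>2"
    using c nn by (simp add: power2_sum)
  finally show ?thesis
    unfolding a_def[symmetric] b_def[symmetric] by (rule real_le_lsqrt[rotated]) (use nn in simp)
qed

lemma lborel_dilate:
  fixes c :: real
  assumes "c \<noteq> 0"
  shows "(lborel :: 'a::euclidean_space measure)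
    = density (distr lborel borel (\<lambda>x. c *\<^sub>R x)) (\<lambda>_. \<bar>c\<bar> ^ DIM('a))"
  using lborel_affine[OF assms, of 0] by simp

lemma square_integrable_translate:
  assumes f: "square_integrable f"
  shows "square_integrable (\<lambda>t. f (t - x))"
proof -
  have m[measurable]: "f \<in> borel_measurable borel" using f by auto
  have "integrable (distr lborel borel ((+) (- x))) (\<lambda>t. (cmod (f t))\<^sup>2)"
    using f by (simp add: lborel_distr_plus square_integrable_def)
  then have "integrable lborel (\<lambda>t. (cmod (f (- x + t)))\<^sup>2)"
    by (subst (asm) integrable_distr_eq) measurable
  then show ?thesis
    by (simp add: square_integrable_def)
qed

lemma AE_lborel_translate:
  fixes x :: "'a::euclidean_space" and P :: "'a \<Rightarrow> bool"
  assumes [measurable]: "Measurable.pred borel P" and P: "AE t in lborel. P t"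
  shows "AE t in lborel. P (t - x)"
proof -
  have "AE t in distr lborel borel ((+) (- x)). P t"
    using P unfolding lborel_distr_plus .
  then show ?thesis
    by (subst (asm) AE_distr_iff) auto
qed

lemma square_integrable_dilate:
  assumes f: "square_integrable f" and c: "c > 0"
  shows "square_integrable (\<lambda>t. f (c *\<^sub>R t))"
proof -
  have m[measurable]: "f \<in> borel_measurable borel" using f by auto
  have "integrable (density (distr lborel borel (\<lambda>x. c *\<^sub>R x)) (\<lambda>_. ennreal (\<bar>c\<bar> ^ CARD('a))))
      (\<lambda>t. (cmod (f t))\<^sup>2)"
    using f lborel_dilate[of c, where 'a="real^'a"] c by (simp add: square_integrable_def)
  then have "integrable lborel (\<lambda>t. (cmod (f (c *\<^sub>R t)))\<^sup>2)"
    using c by (subst (asm) integrable_density) (auto simp: integrable_distr_eq)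
  then show ?thesis
    by (simp add: square_integrable_def)
qed

lemma AE_lborel_dilate:
  fixes P :: "'a::euclidean_space \<Rightarrow> bool"
  assumes [measurable]: "Measurable.pred borel P" and P: "AE t in lborel. P t" and c: "c > 0"
  shows "AE t in lborel. P (c *\<^sub>R t)"
proof -
  have "AE t in density (distr lborel borel (\<lambda>x. c *\<^sub>R x)) (\<lambda>_. ennreal (\<bar>c\<bar> ^ DIM('a))). P t"
    using P c by (subst lborel_dilate[symmetric]) auto
  then show ?thesis
    using c by (simp add: AE_density AE_distr_iff)
qed

definition L2_rel :: "(real^'d::finite \<Rightarrow> complex) \<Rightarrow> (real^'d \<Rightarrow> complex) \<Rightarrow> bool" where
  "L2_rel f g \<longleftrightarrow> square_integrable f \<and> square_integrable g \<and> (AE t in lborel. f t = g t)"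

lemma part_equivp_L2_rel: "part_equivp L2_rel"
proof (rule part_equivpI)
  show "\<exists>f::real^'d \<Rightarrow> complex. L2_rel f f"
    using square_integrable_zero by (auto simp: L2_rel_def)
  show "symp (L2_rel :: (real^'d \<Rightarrow> complex) \<Rightarrow> _)"
    by (rule sympI) (auto simp: L2_rel_def elim: eventually_mono)
  show "transp (L2_rel :: (real^'d \<Rightarrow> complex) \<Rightarrow> _)"
    by (rule transpI) (auto simp: L2_rel_def elim: eventually_elim2)
qed

quotient_type (overloaded) 'd L2 = "real^'d::finite \<Rightarrow> complex" / partial: L2_rel
  morphisms rep_L2 to_L2
  by (rule part_equivp_L2_rel)

instantiation L2 :: (finite) real_normed_vector
begin

lift_definition zero_L2 :: "'a L2" is "\<lambda>_. 0"
  by (simp add: L2_rel_def square_integrable_zero)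

lift_definition plus_L2 :: "'a L2 \<Rightarrow> 'a L2 \<Rightarrow> 'a L2" is "\<lambda>f g t. f t + g t"
  by (auto simp: L2_rel_def intro: square_integrable_add)

lift_definition scaleR_L2 :: "real \<Rightarrow> 'a L2 \<Rightarrow> 'a L2" is "\<lambda>c f t. complex_of_real c * f t"
  by (auto simp: L2_rel_def intro: square_integrable_cmult)

lift_definition uminus_L2 :: "'a L2 \<Rightarrow> 'a L2" is "\<lambda>f t. - f t"
  using square_integrable_cmult[where c="-1"] by (auto simp: L2_rel_def)

definition minus_L2 :: "'a L2 \<Rightarrow> 'a L2 \<Rightarrow> 'a L2" where
  "f - g = f + - (g :: 'a L2)"

lift_definition norm_L2 :: "'a L2 \<Rightarrow> real" is
  "\<lambda>f. sqrt (\<integral>t. (cmod (f t))\<^sup>2 \<partial>lborel)"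
  by (auto simp: L2_rel_def intro!: integral_cong_AE)

definition dist_L2 :: "'a L2 \<Rightarrow> 'a L2 \<Rightarrow> real" where
  "dist_L2 f g = norm (f - g)"

definition sgn_L2 :: "'a L2 \<Rightarrow> 'a L2" where
  "sgn_L2 f = inverse (norm f) *\<^sub>R f"

definition uniformity_L2 :: "('a L2 \<times> 'a L2) filter" where
  "uniformity_L2 = (INF e\<in>{0<..}. principal {(x, y). dist x y < e})"

definition open_L2 :: "'a L2 set \<Rightarrow> bool" where
  "open_L2 U = (\<forall>x\<in>U. eventually (\<lambda>(x', y). x' = x \<longrightarrow> y \<in> U) uniformity)"

instance
proof
  fix a b :: real and x y z :: "'a L2"
  show "x + y + z = x + (y + z)"
    by transfer (auto simp: L2_rel_def add.assoc intro!: square_integrable_add)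
  show "x + y = y + x"
    by transfer (auto simp: L2_rel_def add.commute intro!: square_integrable_add)
  show "0 + x = x"
    by transfer (auto simp: L2_rel_def)
  show "- x + x = 0"
    by transfer (auto simp: L2_rel_def square_integrable_zero)
  show "x - y = x + - y"
    by (rule minus_L2_def)
  show "a *\<^sub>R (x + y) = a *\<^sub>R x + a *\<^sub>R y"
    by transfer (auto simp: L2_rel_def ring_distribs
        intro!: square_integrable_add square_integrable_cmult)
  show "(a + b) *\<^sub>R x = a *\<^sub>R x + b *\<^sub>R x"
    by transfer (auto simp: L2_rel_def ring_distribs
        intro!: square_integrable_add square_integrable_cmult)
  show "a *\<^sub>R b *\<^sub>R x = (a * b) *\<^sub>R x"
    by transfer (auto simp: L2_rel_def mult.assoc intro!: square_integrable_cmult)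
  show "1 *\<^sub>R x = x"
    by transfer (auto simp: L2_rel_def)
  show "dist x y = norm (x - y)"
    by (rule dist_L2_def)
  show "sgn x = inverse (norm x) *\<^sub>R x"
    by (rule sgn_L2_def)
  show "uniformity = (INF e\<in>{0<..}. principal {(x :: 'a L2, y). dist x y < e})"
    by (rule uniformity_L2_def)
  show "open U = (\<forall>x\<in>U. \<forall>\<^sub>F (x', y) in uniformity. x' = x \<longrightarrow> y \<in> U)" for U :: "'a L2 set"
    by (rule open_L2_def)
  show "norm x = 0 \<longleftrightarrow> x = 0"
  proof transfer
    fix f :: "real^'a \<Rightarrow> complex"
    assume "L2_rel f f"
    then have f: "square_integrable f" by (simp add: L2_rel_def)
    then have "(\<integral>t. (cmod (f t))\<^sup>2 \<partial>lborel) = 0 \<longleftrightarrow> (AE t in lborel. (cmod (f t))\<^sup>2 = 0)"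
      by (intro integral_nonneg_eq_0_iff_AE) (auto simp: square_integrable_def)
    then show "sqrt (\<integral>t. (cmod (f t))\<^sup>2 \<partial>lborel) = 0 \<longleftrightarrow> L2_rel f (\<lambda>_. 0)"
      using f by (simp add: L2_rel_def square_integrable_zero)
  qed
  show "norm (x + y) \<le> norm x + norm y"
    by transfer (auto simp: L2_rel_def intro: Minkowski_square_integrable)
  show "norm (a *\<^sub>R x) = \<bar>a\<bar> * norm x"
    by transfer (simp add: norm_mult power_mult_distrib real_sqrt_mult)
qed

end

text \<open>Linear in the first argument.\<close>

lift_definition cinner_L2 :: "'d::finite L2 \<Rightarrow> 'd L2 \<Rightarrow> complex" is
  "\<lambda>f g. \<integral>t. f t * cnj (g t) \<partial>lborel"
proof -
  fix f f' g g' :: "real^'d \<Rightarrow> complex"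
  assume "L2_rel f f'" "L2_rel g g'"
  then have m[measurable]:
      "f \<in> borel_measurable borel" "f' \<in> borel_measurable borel"
      "g \<in> borel_measurable borel" "g' \<in> borel_measurable borel"
    and "AE t in lborel. f t = f' t" "AE t in lborel. g t = g' t"
    by (auto simp: L2_rel_def)
  then have "AE t in lborel. f t * cnj (g t) = f' t * cnj (g' t)"
    by (auto elim: eventually_elim2)
  then show "(\<integral>t. f t * cnj (g t) \<partial>lborel) = (\<integral>t. f' t * cnj (g' t) \<partial>lborel)"
    by (intro integral_cong_AE) simp_all
qed

definition fourier :: "(real^'d::finite \<Rightarrow> complex) \<Rightarrow> real^'d \<Rightarrow> complex" where
  "fourier f \<omega> = (\<integral>t. f t * exp (- (2 * pi * \<i> * complex_of_real (\<omega> \<bullet> t))) \<partial>lborel)"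

text \<open>
  The extension of the Fourier transform from \<open>L\<^sup>1 \<inter> L\<^sup>2\<close> to \<open>L\<^sup>2\<close> by continuity: the graph of the
  extension is the closure in \<open>L\<^sup>2 \<times> L\<^sup>2\<close> of the graph of the integral transform. By Plancherel's
  theorem the condition on \<open>fourier f\<close> always holds and the closure is the graph of a total function;
  the condition only ensures that \<open>to_L2\<close> is applied to square-integrable functions.
\<close>

definition has_fourier_L2 :: "'d::finite L2 \<Rightarrow> 'd L2 \<Rightarrow> bool" where
  "has_fourier_L2 g h \<longleftrightarrow>
     (g, h) \<in> closure {(to_L2 f, to_L2 (fourier f)) | f.
       integrable lborel f \<and> square_integrable f \<and> square_integrable (fourier f)}"

text \<open>
  Elements of \<open>L\<^sup>2\<close> are defined only almost everywhere, so an identity required at every nonzero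
  frequency is a statement about a representative of the Fourier transform.
\<close>

definition admissible :: "'d::finite L2 \<Rightarrow> bool" where
  "admissible g \<longleftrightarrow>
     (\<exists>G. square_integrable G \<and> has_fourier_L2 g (to_L2 G) \<and>
       (\<forall>\<omega>. \<omega> \<noteq> 0 \<longrightarrow>
         (\<integral>\<^sup>+ t \<in> {0<..}. ennreal ((cmod (G (t *\<^sub>R \<omega>)))\<^sup>2 / t) \<partial>lborel) = 1))"

lift_definition translate_L2 :: "real^'d \<Rightarrow> 'd::finite L2 \<Rightarrow> 'd L2" is
  "\<lambda>x f t. f (t - x)"
proof -
  fix x :: "real^'d" and f g :: "real^'d \<Rightarrow> complex"
  assume *: "L2_rel f g"
  then have [measurable]: "f \<in> borel_measurable borel" "g \<in> borel_measurable borel"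
    by (auto simp: L2_rel_def)
  have "AE t in lborel. f (t - x) = g (t - x)"
    using * by (intro AE_lborel_translate[where P="\<lambda>t. f t = g t"]) (auto simp: L2_rel_def)
  then show "L2_rel (\<lambda>t. f (t - x)) (\<lambda>t. g (t - x))"
    using * by (auto simp: L2_rel_def intro: square_integrable_translate)
qed

text \<open>Only positive scales are meaningful; the value \<open>0\<close> at other scales is a dummy.\<close>

lift_definition dilate_L2 :: "real \<Rightarrow> 'd::finite L2 \<Rightarrow> 'd L2" is
  "\<lambda>s f t. if s > 0
     then complex_of_real (s powr (- (real CARD('d) / 2))) * f (inverse s *\<^sub>R t) else 0"
proof -
  fix s :: real and f g :: "real^'d \<Rightarrow> complex"
  assume *: "L2_rel f g"
  then have [measurable]: "f \<in> borel_measurable borel" "g \<in> borel_measurable borel"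
    by (auto simp: L2_rel_def)
  let ?D = "\<lambda>f t. if s > 0
     then complex_of_real (s powr (- (real CARD('d) / 2))) * f (inverse s *\<^sub>R t) else 0"
  show "L2_rel (?D f) (?D g)"
  proof (cases "s > 0")
    case True
    have "AE t in lborel. f (inverse s *\<^sub>R t) = g (inverse s *\<^sub>R t)"
      using * True
      by (intro AE_lborel_dilate[where P="\<lambda>t. f t = g t"]) (auto simp: L2_rel_def)
    then show ?thesis
      using * True
      by (auto simp: L2_rel_def intro!: square_integrable_cmult square_integrable_dilate)
  next
    case False
    then show ?thesis by (simp add: L2_rel_def square_integrable_zero)
  qed
qed

definition wavelet_transform :: "'d::finite L2 \<Rightarrow> 'd L2 \<Rightarrow> real^'d \<Rightarrow> real \<Rightarrow> complex" where
  "wavelet_transform g f x s = cinner_L2 f (translate_L2 x (dilate_L2 s g))"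

definition ennreal_sqrt :: "ennreal \<Rightarrow> ennreal" where
  "ennreal_sqrt a = (if a = \<infinity> then \<infinity> else ennreal (sqrt (enn2real a)))"

end

theory Submission
  imports Defs "HOL-Probability.Characteristic_Functions"
begin

text \<open>
  The theorem rests on the isometry
  \<open>\<integral>\<integral> \<bar>W\<^sub>g f (x, s)\<bar>\<^sup>2 dx ds / s\<^bsup>d+1\<^esup> = \<parallel>f\<parallel>\<^sup>2\<close> (\<open>wavelet_isometry\<close>), which says that the
  energy of \<open>f\<close> is distributed over the half-space by its wavelet transform, and on the
  fact that the wavelet atoms \<open>T\<^sub>x D\<^sub>s g\<close> depend continuously on \<open>(x, s)\<close> in the norm of
  \<open>L\<^sup>2\<close> (\<open>continuous_on_wavelet_atom\<close>).

  If \<open>S\<close> is compact, it is covered up to \<open>\<epsilon>\<close> by finitely many of its elements. The energy of each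
  of them is finite, so it escapes a large box by at most \<open>\<epsilon>\<close>; the isometry bounds the energy of
  the remaining difference by its norm.

  Conversely, suppose that all \<open>f \<in> S\<close> have little energy outside a compact set \<open>U\<close>. The atoms
  with parameters in \<open>U\<close> form a compact subset of \<open>L\<^sup>2\<close>, so they are approximated by finitely many
  vectors. As \<open>S\<close> is bounded, it splits into finitely many classes on each of which the inner
  products with these vectors are almost constant. For \<open>f\<close> and \<open>h\<close> in one class the transform of
  \<open>f - h\<close> is uniformly small on \<open>U\<close>, a set of finite invariant measure, and has little energy
  outside \<open>U\<close>; by the isometry \<open>\<parallel>f - h\<parallel>\<close> is small. Hence \<open>S\<close> is totally bounded, and as a closed
  subset of the complete space \<open>L\<^sup>2\<close> it is compact.

  The isometry comes from the Fourier transform. At a fixed scale, \<open>x \<mapsto> W\<^sub>g f (x, s)\<close> is the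
  correlation of \<open>f\<close> with the dilated wavelet, whose Fourier transform is the product of one
  transform and the conjugate of the other. Plancherel's theorem turns the integral over \<open>x\<close> into
  \<open>s\<^sup>d \<integral> \<bar>f\<^sup>^(\<omega>)\<bar>\<^sup>2 \<bar>g\<^sup>^(s \<omega>)\<bar>\<^sup>2 d\<omega>\<close>. Integrating over \<open>ds / s\<^bsup>d+1\<^esup>\<close> first makes the
  admissibility integral appear, which is \<open>1\<close>, and Plancherel's theorem once more leaves \<open>\<parallel>f\<parallel>\<^sup>2\<close>.
  Plancherel's theorem is itself an instance of the correlation formula: \<open>\<bar>f\<^sup>^\<bar>\<^sup>2\<close> is the Fourier
  transform of the autocorrelation of \<open>f\<close>, a continuous function with value \<open>\<parallel>f\<parallel>\<^sup>2\<close> at \<open>0\<close>, and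
  averaging against Gaussians recovers this value from the transform.

  These computations need integrable functions. They pass to all of \<open>L\<^sup>2\<close>, first in the wavelet
  and then in the signal, by the limit principle \<open>nn_integral_isometry_limit\<close>.
\<close>

section \<open>Square-integrable functions and their classes\<close>

lemma L2_rel_self_iff: "L2_rel f f \<longleftrightarrow> square_integrable f"
  by (auto simp: L2_rel_def)

lemma L2_cases:
  obtains F where "square_integrable F" "f = to_L2 F"
  using that Quotient_rep_reflp[OF Quotient_L2] Quotient_abs_rep[OF Quotient_L2]
  by (metis L2_rel_self_iff)

lemma square_integrable_diff:
  "square_integrable f \<Longrightarrow> square_integrable g \<Longrightarrow> square_integrable (\<lambda>t. f t - g t)"
  using square_integrable_add[of f "\<lambda>t. (-1) * g t"] square_integrable_cmult[of g "-1"] by simp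

lemma norm_to_L2: "square_integrable f \<Longrightarrow> norm (to_L2 f) = sqrt (\<integral>t. (cmod (f t))\<^sup>2 \<partial>lborel)"
  by (simp add: norm_L2.abs_eq L2_rel_self_iff)

lemma add_to_L2:
  "square_integrable f \<Longrightarrow> square_integrable g \<Longrightarrow> to_L2 f + to_L2 g = to_L2 (\<lambda>t. f t + g t)"
  by (simp add: plus_L2.abs_eq L2_rel_self_iff)

lemma diff_to_L2:
  "square_integrable f \<Longrightarrow> square_integrable g \<Longrightarrow> to_L2 f - to_L2 g = to_L2 (\<lambda>t. f t - g t)"
  using square_integrable_cmult[of g "-1"]
  by (simp add: minus_L2_def uminus_L2.abs_eq plus_L2.abs_eq L2_rel_self_iff)

lemma cinner_to_L2:
  "square_integrable f \<Longrightarrow> square_integrable g \<Longrightarrow>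
    cinner_L2 (to_L2 f) (to_L2 g) = (\<integral>t. f t * cnj (g t) \<partial>lborel)"
  by (simp add: cinner_L2.abs_eq L2_rel_self_iff)

lemma translate_to_L2: "square_integrable f \<Longrightarrow> translate_L2 x (to_L2 f) = to_L2 (\<lambda>t. f (t - x))"
  by (simp add: translate_L2.abs_eq L2_rel_self_iff)

lemma dilate_to_L2:
  fixes f :: "real^'d::finite \<Rightarrow> complex"
  shows "square_integrable f \<Longrightarrow> s > 0 \<Longrightarrow> dilate_L2 s (to_L2 f) =
    to_L2 (\<lambda>t. complex_of_real (s powr (- (real CARD('d) / 2))) * f (inverse s *\<^sub>R t))"
  by (simp add: dilate_L2.abs_eq L2_rel_self_iff)

lemma square_integrableI_nn:
  assumes [measurable]: "f \<in> borel_measurable borel"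
    and "(\<integral>\<^sup>+t. ennreal ((cmod (f t))\<^sup>2) \<partial>lborel) < \<infinity>"
  shows "square_integrable f"
  using assms by (auto simp: square_integrable_def integrable_iff_bounded)

text \<open>
  Norms and distances are handled as nonnegative integrals, so that Tonelli's theorem and Fatou's
  lemma apply to them directly.
\<close>
lemma nn_integral_norm_to_L2:
  assumes "square_integrable f"
  shows "(\<integral>\<^sup>+t. ennreal ((cmod (f t))\<^sup>2) \<partial>lborel) = ennreal ((norm (to_L2 f))\<^sup>2)"
  using assms by (simp add: norm_to_L2 nn_integral_eq_integral square_integrable_def)

lemma nn_integral_dist_to_L2:
  assumes "square_integrable f" "square_integrable g"
  shows "(\<integral>\<^sup>+t. ennreal ((cmod (f t - g t))\<^sup>2) \<partial>lborel) = ennreal ((dist (to_L2 f) (to_L2 g))\<^sup>2)"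
  using assms by (simp add: dist_norm diff_to_L2 nn_integral_norm_to_L2 square_integrable_diff)

lemma norm_cinner_L2_le: "cmod (cinner_L2 f g) \<le> norm f * norm g"
proof -
  obtain F where F: "square_integrable F" "f = to_L2 F" by (rule L2_cases)
  obtain G where G: "square_integrable G" "g = to_L2 G" by (rule L2_cases)
  have [measurable]: "F \<in> borel_measurable borel" "G \<in> borel_measurable borel"
    using F G by auto
  have "ennreal (cmod (cinner_L2 f g)) \<le> (\<integral>\<^sup>+t. norm (F t * cnj (G t)) \<partial>lborel)"
    using F G by (simp add: cinner_to_L2 integral_norm_bound_ennreal square_integrable_mult_cnj)
  also have "\<dots> = (\<integral>\<^sup>+t. ennreal (cmod (F t)) * ennreal (cmod (G t)) \<partial>lborel)"
    by (simp add: norm_mult ennreal_mult)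
  finally have "(ennreal (cmod (cinner_L2 f g)))\<^sup>2
      \<le> (\<integral>\<^sup>+t. ennreal (cmod (F t)) * ennreal (cmod (G t)) \<partial>lborel)\<^sup>2"
    by (intro power_mono) auto
  also have "\<dots> \<le> (\<integral>\<^sup>+t. (ennreal (cmod (F t)))\<^sup>2 \<partial>lborel) * (\<integral>\<^sup>+t. (ennreal (cmod (G t)))\<^sup>2 \<partial>lborel)"
    by (rule Cauchy_Schwarz_nn_integral) measurable
  also have "\<dots> = ennreal ((norm f)\<^sup>2) * ennreal ((norm g)\<^sup>2)"
    using F G by (simp add: nn_integral_norm_to_L2 ennreal_power)
  finally have "(cmod (cinner_L2 f g))\<^sup>2 \<le> (norm f * norm g)\<^sup>2"
    by (simp add: ennreal_power flip: ennreal_mult power_mult_distrib)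
  then show ?thesis
    by (rule power2_le_imp_le) simp
qed

lemma cinner_L2_diff_left: "cinner_L2 (f - f') g = cinner_L2 f g - cinner_L2 f' g"
proof -
  obtain F where F: "square_integrable F" "f = to_L2 F" by (rule L2_cases)
  obtain F' where F': "square_integrable F'" "f' = to_L2 F'" by (rule L2_cases)
  obtain G where G: "square_integrable G" "g = to_L2 G" by (rule L2_cases)
  show ?thesis
    using F F' G
    by (simp add: diff_to_L2 cinner_to_L2 square_integrable_diff square_integrable_mult_cnj
        ring_distribs)
qed

lemma cinner_L2_diff_right: "cinner_L2 f (g - g') = cinner_L2 f g - cinner_L2 f g'"
proof -
  obtain F where F: "square_integrable F" "f = to_L2 F" by (rule L2_cases)
  obtain G where G: "square_integrable G" "g = to_L2 G" by (rule L2_cases)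
  obtain G' where G': "square_integrable G'" "g' = to_L2 G'" by (rule L2_cases)
  show ?thesis
    using F G G'
    by (simp add: diff_to_L2 cinner_to_L2 square_integrable_diff square_integrable_mult_cnj
        ring_distribs)
qed

lemma cinner_L2_self: "cinner_L2 f f = of_real ((norm f)\<^sup>2)"
proof -
  obtain F where F: "square_integrable F" "f = to_L2 F" by (rule L2_cases)
  then show ?thesis
    by (simp add: cinner_to_L2 norm_to_L2 complex_norm_square[symmetric] del: of_real_power)
qed

lemma tendsto_cinner_L2:
  assumes "(f \<longlongrightarrow> a) F" "(g \<longlongrightarrow> b) F"
  shows "((\<lambda>x. cinner_L2 (f x) (g x)) \<longlongrightarrow> cinner_L2 a b) F"
proof (rule LIM_zero_cancel)
  have "((\<lambda>x. norm (f x - a) * norm (g x) + norm a * norm (g x - b)) \<longlongrightarrow>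
      norm (a - a) * norm b + norm a * norm (b - b)) F"
    by (intro tendsto_intros assms)
  then have lim: "((\<lambda>x. norm (f x - a) * norm (g x) + norm a * norm (g x - b)) \<longlongrightarrow> 0) F"
    by simp
  have "cmod (cinner_L2 (f x) (g x) - cinner_L2 a b)
      \<le> norm (f x - a) * norm (g x) + norm a * norm (g x - b)" for x
  proof -
    have "cinner_L2 (f x) (g x) - cinner_L2 a b = cinner_L2 (f x - a) (g x) + cinner_L2 a (g x - b)"
      by (simp add: cinner_L2_diff_left cinner_L2_diff_right)
    then show ?thesis
      by (metis add_mono norm_cinner_L2_le norm_triangle_le)
  qed
  then show "((\<lambda>x. cinner_L2 (f x) (g x) - cinner_L2 a b) \<longlongrightarrow> 0) F"
    by (intro Lim_null_comparison[OF _ lim]) simp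
qed

text \<open>
  The way in which an \<open>L\<^sup>2\<close> bound passes to a pointwise limit; it serves completeness as well as the
  extension of isometries from dense sets.
\<close>
lemma nn_integral_square_Fatou:
  fixes u :: "nat \<Rightarrow> 'a \<Rightarrow> complex"
  assumes [measurable]: "\<And>n. u n \<in> borel_measurable M" "v \<in> borel_measurable M"
    and lim: "AE x in M. (\<lambda>n. u n x) \<longlonglongrightarrow> v x"
    and le: "\<forall>\<^sub>F n in sequentially. (\<integral>\<^sup>+x. ennreal ((cmod (u n x))\<^sup>2) \<partial>M) \<le> C"
  shows "(\<integral>\<^sup>+x. ennreal ((cmod (v x))\<^sup>2) \<partial>M) \<le> C"
proof -
  have "(\<integral>\<^sup>+x. ennreal ((cmod (v x))\<^sup>2) \<partial>M) = (\<integral>\<^sup>+x. liminf (\<lambda>n. ennreal ((cmod (u n x))\<^sup>2)) \<partial>M)"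
  proof (rule nn_integral_cong_AE)
    show "AE x in M. ennreal ((cmod (v x))\<^sup>2) = liminf (\<lambda>n. ennreal ((cmod (u n x))\<^sup>2))"
      using lim
    proof eventually_elim
      case (elim x)
      have "(\<lambda>n. ennreal ((cmod (u n x))\<^sup>2)) \<longlonglongrightarrow> ennreal ((cmod (v x))\<^sup>2)"
        by (intro tendsto_ennrealI tendsto_intros elim)
      then show ?case
        using lim_imp_Liminf[OF sequentially_bot] by metis
    qed
  qed
  also have "\<dots> \<le> liminf (\<lambda>n. \<integral>\<^sup>+x. ennreal ((cmod (u n x))\<^sup>2) \<partial>M)"
    by (rule nn_integral_liminf) measurable
  also have "\<dots> \<le> liminf (\<lambda>n. C)"
    using le by (rule Liminf_mono)
  finally show ?thesis
    by (simp add: Liminf_const)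
qed

lemma square_integrable_dominated:
  assumes [measurable]: "u \<in> borel_measurable borel"
    and w: "integrable lborel (\<lambda>t. (w t)\<^sup>2)" and le: "\<And>t. cmod (u t) \<le> w t"
  shows "square_integrable u"
  unfolding square_integrable_def
proof
  show "integrable lborel (\<lambda>t. (cmod (u t))\<^sup>2)"
    by (rule Bochner_Integration.integrable_bound[OF w]) (auto intro!: power_mono le)
qed simp

lemma tendsto_to_L2_dominated:
  fixes u :: "nat \<Rightarrow> real^'d::finite \<Rightarrow> complex"
  assumes [measurable]: "\<And>n. u n \<in> borel_measurable borel" "v \<in> borel_measurable borel"
    and w: "integrable lborel (\<lambda>t. (w t)\<^sup>2)" and wm [measurable]: "w \<in> borel_measurable borel"
    and le: "\<And>n t. cmod (u n t) \<le> w t" "\<And>t. cmod (v t) \<le> w t"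
    and lim: "\<And>t. (\<lambda>n. u n t) \<longlonglongrightarrow> v t"
  shows "(\<lambda>n. to_L2 (u n)) \<longlonglongrightarrow> to_L2 v"
proof -
  have sq: "square_integrable (u n)" "square_integrable v" for n
    by (auto intro!: square_integrable_dominated[OF _ w] le)
  have "(\<lambda>n. \<integral>t. (cmod (u n t - v t))\<^sup>2 \<partial>lborel) \<longlonglongrightarrow> (\<integral>t. 0 \<partial>(lborel::(real^'d) measure))"
  proof (rule integral_dominated_convergence[where w="\<lambda>t. 4 * (w t)\<^sup>2"])
    show "AE t in lborel. (\<lambda>n. (cmod (u n t - v t))\<^sup>2) \<longlonglongrightarrow> 0"
    proof
      fix t
      have "(\<lambda>n. (cmod (u n t - v t))\<^sup>2) \<longlonglongrightarrow> (cmod (v t - v t))\<^sup>2"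
        by (intro tendsto_intros lim)
      then show "(\<lambda>n. (cmod (u n t - v t))\<^sup>2) \<longlonglongrightarrow> 0" by simp
    qed
    have "(cmod (u n t - v t))\<^sup>2 \<le> 4 * (w t)\<^sup>2" for n t
    proof -
      have "cmod (u n t - v t) \<le> 2 * w t"
        using norm_triangle_ineq4[of "u n t" "v t"] le(1)[of n t] le(2)[of t] by linarith
      then have "(cmod (u n t - v t))\<^sup>2 \<le> (2 * w t)\<^sup>2"
        by (intro power_mono) auto
      then show ?thesis by (simp add: power_mult_distrib)
    qed
    then show "AE t in lborel. norm ((cmod (u n t - v t))\<^sup>2) \<le> 4 * (w t)\<^sup>2" for n
      by simp
  qed (use w in auto)
  then have "(\<lambda>n. sqrt (\<integral>t. (cmod (u n t - v t))\<^sup>2 \<partial>lborel)) \<longlonglongrightarrow> sqrt 0"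
    by (intro tendsto_real_sqrt) simp
  then show ?thesis
    using sq by (subst tendsto_dist_iff)
      (simp add: dist_norm diff_to_L2 norm_to_L2 square_integrable_diff)
qed

section \<open>Completeness\<close>

text \<open>
  The weighted sum \<open>\<Sum>n. 4\<^sup>n \<bar>F\<^sub>n - F\<^bsub>n+1\<^esub>\<bar>\<^sup>2\<close> has integral at most \<open>\<Sum>n. 4\<^sup>n 16\<^bsup>-n\<^esup> < \<infinity>\<close>, hence is finite
  almost everywhere. Where it is finite, the increments are \<open>O(2\<^bsup>-n\<^esup>)\<close> and the sequence converges.
\<close>
lemma Cauchy_L2_rep_limit:
  fixes F :: "nat \<Rightarrow> real^'d::finite \<Rightarrow> complex"
  assumes F: "\<And>n. square_integrable (F n)"
    and step: "\<And>n. dist (to_L2 (F n)) (to_L2 (F (Suc n))) \<le> (1/4) ^ n"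
  obtains G where "G \<in> borel_measurable borel" "AE t in lborel. (\<lambda>n. F n t) \<longlonglongrightarrow> G t"
proof
  have m[measurable]: "F n \<in> borel_measurable borel" for n
    using F by auto
  let ?G = "\<lambda>t. lim (\<lambda>n. F n t)"
  show "?G \<in> borel_measurable borel"
    by measurable
  define w :: "nat \<Rightarrow> real^'d \<Rightarrow> real" where "w n t = 4 ^ n * (cmod (F n t - F (Suc n) t))\<^sup>2" for n t
  have [measurable]: "w n \<in> borel_measurable borel" for n
    unfolding w_def by measurable
  have "(\<integral>\<^sup>+t. (\<Sum>n. ennreal (w n t)) \<partial>lborel) = (\<Sum>n. \<integral>\<^sup>+t. ennreal (w n t) \<partial>lborel)"
    by (rule nn_integral_suminf) measurable
  also have "\<dots> \<le> (\<Sum>n. ennreal ((1/4) ^ n))"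
  proof (rule suminf_le)
    fix n
    have "(\<integral>\<^sup>+t. ennreal (w n t) \<partial>lborel)
        = ennreal (4 ^ n * (dist (to_L2 (F n)) (to_L2 (F (Suc n))))\<^sup>2)"
      by (simp add: w_def ennreal_mult nn_integral_cmult nn_integral_dist_to_L2 F)
    also have "\<dots> \<le> ennreal (4 ^ n * ((1/4) ^ n)\<^sup>2)"
      by (intro ennreal_leI mult_left_mono power_mono step) auto
    also have "4 ^ n * ((1/4::real) ^ n)\<^sup>2 = (1/4) ^ n"
      by (simp add: power2_eq_square power_divide)
    finally show "(\<integral>\<^sup>+t. ennreal (w n t) \<partial>lborel) \<le> ennreal ((1/4) ^ n)" .
  qed auto
  also have "\<dots> < \<infinity>"
    by (subst suminf_ennreal_eq[OF _ geometric_sums]) auto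
  finally have "AE t in lborel. (\<Sum>n. ennreal (w n t)) \<noteq> \<infinity>"
    by (intro nn_integral_PInf_AE) auto
  then show "AE t in lborel. (\<lambda>n. F n t) \<longlonglongrightarrow> ?G t"
  proof eventually_elim
    case (elim t)
    have "summable (\<lambda>n. w n t)"
      using elim by (intro summable_suminf_not_top) (auto simp: w_def)
    then have "Bseq (\<lambda>n. w n t)"
      by (intro convergent_imp_Bseq) (auto simp: convergent_def dest: summable_LIMSEQ_zero)
    then obtain C where C: "\<And>n. norm (w n t) \<le> C"
      by (auto simp: Bseq_def)
    have "summable (\<lambda>n. F (Suc n) t - F n t)"
    proof (rule summable_comparison_test)
      have "cmod (F (Suc n) t - F n t) \<le> sqrt C * (1/2) ^ n" for n
      proof -
        have "(2 ^ n * cmod (F (Suc n) t - F n t))\<^sup>2 = w n t"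
          using power_mult[of "2::real" n 2] power_mult[of "2::real" 2 n]
          by (simp add: w_def power_mult_distrib norm_minus_commute mult.commute)
        also have "\<dots> \<le> C"
          using C[of n] by simp
        finally have "2 ^ n * cmod (F (Suc n) t - F n t) \<le> sqrt C"
          by (rule real_le_rsqrt)
        then show ?thesis
          by (simp add: field_simps)
      qed
      then show "\<exists>N. \<forall>n\<ge>N. cmod (F (Suc n) t - F n t) \<le> sqrt C * (1/2) ^ n"
        by blast
      show "summable (\<lambda>n. sqrt C * (1/2) ^ n)"
        by (intro summable_mult summable_geometric) simp
    qed
    then have "(\<lambda>n. \<Sum>i<n. F (Suc i) t - F i t) \<longlonglongrightarrow> (\<Sum>n. F (Suc n) t - F n t)"
      by (rule summable_LIMSEQ)
    then have "(\<lambda>n. (F n t - F 0 t) + F 0 t) \<longlonglongrightarrow> (\<Sum>n. F (Suc n) t - F n t) + F 0 t"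
      by (intro tendsto_add tendsto_const) (simp add: sum_lessThan_telescope[of "\<lambda>i. F i t"])
    then have "convergent (\<lambda>n. F n t)"
      by (auto simp: convergent_def)
    then show ?case
      by (simp add: convergent_LIMSEQ_iff)
  qed
qed

text \<open>
  Riesz and Fischer: a fast subsequence has a pointwise limit, and Fatou's lemma turns the Cauchy
  bounds between members of the sequence into bounds for the distance to that limit.
\<close>
theorem complete_L2: "complete (UNIV :: 'd::finite L2 set)"
proof (rule completeI)
  fix X :: "nat \<Rightarrow> 'd L2"
  assume X: "Cauchy X"
  have "\<forall>n. \<exists>N. \<forall>i\<ge>N. \<forall>j\<ge>N. dist (X i) (X j) < (1/4) ^ n"
    using X by (auto simp: Cauchy_def)
  then obtain N where N: "\<And>n i j. i \<ge> N n \<Longrightarrow> j \<ge> N n \<Longrightarrow> dist (X i) (X j) < (1/4) ^ n"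
    by metis
  \<comment> \<open>Adding up the thresholds gives monotone indices beyond \<open>N n\<close>; the summand \<open>n\<close> makes
    them tend to infinity.\<close>
  define r where "r n = n + (\<Sum>i\<le>n. N i)" for n
  have r: "N n \<le> r n" "n \<le> r n" "r n \<le> r (Suc n)" for n
    by (simp_all add: r_def) (metis add_leD2 atMost_iff finite_atMost le_add1 le_add2 member_le_sum
        order_refl order_trans zero_le)
  have "\<forall>n. \<exists>f. square_integrable f \<and> X (r n) = to_L2 f"
    using L2_cases by blast
  then have "\<exists>F. \<forall>n. square_integrable (F n) \<and> X (r n) = to_L2 (F n)"
    by (rule choice)
  then obtain F where F: "\<And>n. square_integrable (F n)" "\<And>n. X (r n) = to_L2 (F n)"
    by auto
  have m[measurable]: "F n \<in> borel_measurable borel" for n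
    using F by auto
  have "dist (to_L2 (F n)) (to_L2 (F (Suc n))) \<le> (1/4) ^ n" for n
    using N[of n "r n" "r (Suc n)"] r(1,3)[of n] by (simp flip: F(2))
  then obtain G where [measurable]: "G \<in> borel_measurable borel"
    and G: "AE t in lborel. (\<lambda>n. F n t) \<longlonglongrightarrow> G t"
    using Cauchy_L2_rep_limit[of F, OF F(1)] by blast
  have bound: "(\<integral>\<^sup>+t. ennreal ((cmod (F n t - G t))\<^sup>2) \<partial>lborel)
      \<le> ennreal (((1/4) ^ k)\<^sup>2)" if "n \<ge> N k" for n k
  proof (rule nn_integral_square_Fatou)
    show "AE t in lborel. (\<lambda>m. F n t - F m t) \<longlonglongrightarrow> F n t - G t"
      using G by eventually_elim (intro tendsto_intros)
    have "(\<integral>\<^sup>+t. ennreal ((cmod (F n t - F m t))\<^sup>2) \<partial>lborel) \<le> ennreal (((1/4) ^ k)\<^sup>2)" if "m \<ge> N k" for m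
      unfolding nn_integral_dist_to_L2[OF F(1) F(1)] F(2)[symmetric]
      using N[of k "r n" "r m"] that \<open>n \<ge> N k\<close> r(2)[of n] r(2)[of m]
      by (intro ennreal_leI power_mono) auto
    then show "\<forall>\<^sub>F m in sequentially. (\<integral>\<^sup>+t. ennreal ((cmod (F n t - F m t))\<^sup>2) \<partial>lborel)
        \<le> ennreal (((1/4) ^ k)\<^sup>2)"
      by (auto simp: eventually_sequentially)
  qed measurable
  have "square_integrable (\<lambda>t. F (N 0) t - G t)"
    using bound[of 0 "N 0"] by (intro square_integrableI_nn) (auto intro: le_less_trans)
  from square_integrable_diff[OF F(1)[of "N 0"] this] have sqG: "square_integrable G"
    by simp
  have XG: "dist (X (r n)) (to_L2 G) \<le> (1/4) ^ k" if "n \<ge> N k" for n k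
    using bound[OF that] unfolding nn_integral_dist_to_L2[OF F(1) sqG] F(2)[symmetric]
    by (simp add: power2_le_iff_abs_le)
  have "X \<longlonglongrightarrow> to_L2 G"
  proof (rule metric_LIMSEQ_I)
    fix e :: real assume "e > 0"
    then obtain k where k: "(1/4::real) ^ k < e / 2"
      using real_arch_pow_inv[of "e/2" "1/4"] by auto
    have "dist (X n) (to_L2 G) < e" if "n \<ge> N k" for n
      using dist_triangle[of "X n" "to_L2 G" "X (r n)"] XG[OF that] N[of k n
          "r n"] r(2)[of n] that k by linarith
    then show "\<exists>no. \<forall>n\<ge>no. dist (X n) (to_L2 G) < e"
      by blast
  qed
  then show "\<exists>l\<in>UNIV. X \<longlonglongrightarrow> l"
    by blast
qed

section \<open>Density of continuous functions\<close>

definition continuous_bounded_support :: "('a::euclidean_space \<Rightarrow> complex) set" where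
  "continuous_bounded_support = {f. continuous_on UNIV f \<and> (\<exists>R. \<forall>t. norm t > R \<longrightarrow> f t = 0)}"

lemma continuous_bounded_support_measurable:
  "f \<in> continuous_bounded_support \<Longrightarrow> f \<in> borel_measurable borel"
  by (auto simp: continuous_bounded_support_def intro: borel_measurable_continuous_onI)

lemma continuous_bounded_support_bound:
  assumes "f \<in> continuous_bounded_support"
  obtains M R where "M \<ge> 0" "\<And>t. cmod (f t) \<le> M * indicator (cball 0 R) t"
proof -
  from assms obtain R where f: "continuous_on UNIV f" and R: "\<And>t. norm t > R \<Longrightarrow> f t = 0"
    by (auto simp: continuous_bounded_support_def)
  have "compact (f ` cball 0 R)"
    by (rule compact_continuous_image) (auto intro: continuous_on_subset[OF f])
  then obtain M where M: "\<And>t. t \<in> cball 0 R \<Longrightarrow> cmod (f t) \<le> M"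
    using compact_imp_bounded bounded_iff by (metis image_eqI)
  show ?thesis
  proof (rule that[of "max 0 M" R])
    show "cmod (f t) \<le> max 0 M * indicator (cball 0 R) t" for t
      using M[of t] R[of t] by (cases "norm t \<le> R") (auto simp: le_max_iff_disj)
  qed simp
qed

lemma integrable_const_on_cball: "integrable lborel (\<lambda>t. (M * indicator (cball 0 R) t :: real)\<^sup>2)"
proof -
  have "integrable lborel (\<lambda>t. M\<^sup>2 * indicator (cball 0 R) t :: real)"
    by (intro integrable_mult_right integrable_real_indicator)
      (use emeasure_lborel_cball_finite[of 0 R] in auto)
  then show ?thesis
    by (simp add: power_mult_distrib power2_eq_square[of "indicator _ _"] indicator_inter_arith[symmetric])
qed

lemma continuous_bounded_support_square_integrable:
  "f \<in> continuous_bounded_support \<Longrightarrow> square_integrable f"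
  by (metis continuous_bounded_support_bound continuous_bounded_support_measurable
      square_integrable_dominated[OF _ integrable_const_on_cball])

text \<open>
  The functions \<open>min 1 (n \<cdot> dist(t, -U))\<close>, cut off near infinity, are continuous, have bounded
  support and increase to the indicator of \<open>U\<close>.
\<close>
lemma to_L2_indicator_open_in_closure:
  fixes U :: "(real^'d::finite) set"
  assumes U: "open U" "emeasure lborel U < \<infinity>"
  shows "to_L2 (\<lambda>t. indicator U t * c) \<in> closure (to_L2 ` continuous_bounded_support)"
proof -
  \<comment> \<open>\<open>infdist\<close> from the empty set is \<open>0\<close> by convention, so \<open>U\<close> must not be the whole space.\<close>
  have ne: "- U \<noteq> {}"
    using U(2) by (metis Compl_UNIV_eq double_complement emeasure_lborel_UNIV less_irrefl
        infinity_ennreal_def)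
  define h where "h n t = complex_of_real (min 1 (real n * infdist t (- U))
      * min 1 (max 0 (real n - norm t))) * c" for n t
  have cont: "continuous_on UNIV (h n)" for n
    unfolding h_def by (intro continuous_intros)
  have h: "h n \<in> continuous_bounded_support" for n
    using cont unfolding continuous_bounded_support_def by (auto simp: h_def intro!: exI[of _ "real n"])
  have [measurable]: "h n \<in> borel_measurable borel" "U \<in> sets borel" for n
    using h continuous_bounded_support_measurable U by auto
  have h0: "infdist t (- U) = 0" if "t \<notin> U" for t
    using in_closed_iff_infdist_zero[of "- U" t] U ne that by auto
  have "(\<lambda>n. to_L2 (h n)) \<longlonglongrightarrow> to_L2 (\<lambda>t. indicator U t * c)"
  proof (rule tendsto_to_L2_dominated[where w = "\<lambda>t. indicator U t * cmod c"])
    have "integrable lborel (\<lambda>t. indicator U t * (cmod c)\<^sup>2)"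
      using U by (intro integrable_mult_left integrable_real_indicator) auto
    then show "integrable lborel (\<lambda>t. (indicator U t * cmod c)\<^sup>2)"
      by (simp add: power_mult_distrib power2_eq_square[of
          "indicator _ _"] indicator_inter_arith[symmetric])
    fix t
    show "cmod (h n t) \<le> indicator U t * cmod c" for n
    proof (cases "t \<in> U")
      case True
      have "\<bar>min 1 (real n * infdist t (- U)) * min 1 (max 0 (real n - norm t))\<bar> \<le> 1"
        by (intro abs_leI mult_le_one) (auto simp: infdist_nonneg
            intro!: order_trans[OF _ mult_nonneg_nonneg])
      then show ?thesis
        using True by (auto simp: h_def norm_mult simp del: of_real_mult
            intro!: mult_left_le_one_le mult_right_le_one_le)
    next
      case False then show ?thesis by (simp add: h_def h0)
    qed
    show "(\<lambda>n. h n t) \<longlonglongrightarrow> indicator U t * c"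
    proof (cases "t \<in> U")
      case True
      then have pos: "infdist t (- U) > 0"
        using infdist_pos_not_in_closed[of "- U" t] U ne by auto
      obtain k where k: "real k > max (1 + norm t) (1 / infdist t (- U))"
        using reals_Archimedean2 by blast
      have "h n t = indicator U t * c" if "n \<ge> k" for n
      proof -
        have n: "real n \<ge> 1 + norm t" "real n \<ge> 1 / infdist t (- U)"
          using k that by linarith+
        then have "real n * infdist t (- U) \<ge> 1"
          using pos by (simp add: field_simps)
        then show ?thesis
          using n True by (simp add: h_def min_absorb1)
      qed
      then show ?thesis
        by (intro tendsto_eventually) (auto simp: eventually_sequentially)
    next
      case False then show ?thesis by (simp add: h_def h0)
    qed
  qed (auto simp: norm_mult indicator_def)
  then show ?thesis
    using h unfolding closure_sequential by (intro exI[of _ "\<lambda>n. to_L2 (h n)"]) auto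
qed

text \<open>
  Outer regularity of Lebesgue measure reduces Borel sets to open sets.
\<close>
lemma to_L2_indicator_in_closure:
  fixes A :: "(real^'d::finite) set"
  assumes A[measurable]: "A \<in> sets borel" and fin: "emeasure lborel A < \<infinity>"
  shows "to_L2 (\<lambda>t. indicator A t * c) \<in> closure (to_L2 ` continuous_bounded_support)" (is "_ \<in> closure ?K")
proof -
  have "\<exists>y\<in>closure ?K. dist y (to_L2 (\<lambda>t. indicator A t * c)) < e" if "e > 0" for e
  proof -
    define e' where "e' = e\<^sup>2 / ((cmod c)\<^sup>2 + 1)"
    have "e' > 0" using that by (simp add: e'_def add_nonneg_pos)
    then obtain U where U: "open U" "A \<subseteq> U" "emeasure lborel (U - A) < e'"
      using outer_regular_lborel[OF A] by blast
    have [measurable]: "U \<in> sets borel" using U by auto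
    have "emeasure lborel U = emeasure lborel A + emeasure lborel (U - A)"
      using U(2) by (subst plus_emeasure) (auto simp: Un_absorb1)
    also have "\<dots> < \<infinity>"
      using fin U(3) by (auto simp: ennreal_add_less_top intro: less_trans)
    finally have finU: "emeasure lborel U < \<infinity>" .
    have sq: "square_integrable (\<lambda>t. indicator B t * c)"
        if [measurable]: "B \<in> sets borel" and "emeasure lborel B < \<infinity>" for B :: "(real^'d) set"
    proof (rule square_integrable_dominated)
      show "integrable lborel (\<lambda>t. (indicator B t * cmod c)\<^sup>2)"
        using integrable_mult_left[OF integrable_real_indicator[of B lborel], of "(cmod c)\<^sup>2"] that
        by (simp add: power_mult_distrib power2_eq_square[of
            "indicator _ _"] indicator_inter_arith[symmetric])
    qed (auto simp: norm_mult indicator_def)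
    have "ennreal ((dist (to_L2 (\<lambda>t. indicator U t * c)) (to_L2 (\<lambda>t. indicator A t * c)))\<^sup>2)
        = (\<integral>\<^sup>+t. ennreal ((cmod (indicator U t * c - indicator A t * c))\<^sup>2) \<partial>lborel)"
      using sq[of U] sq[of A] finU fin by (simp add: nn_integral_dist_to_L2)
    also have "\<dots> = (\<integral>\<^sup>+t. ennreal ((cmod c)\<^sup>2) * indicator (U - A) t \<partial>lborel)"
      using U(2) by (intro nn_integral_cong) (auto simp: indicator_def)
    also have "\<dots> = ennreal ((cmod c)\<^sup>2) * emeasure lborel (U - A)"
      by (simp add: nn_integral_cmult_indicator)
    also have "\<dots> \<le> ennreal ((cmod c)\<^sup>2) * ennreal e'"
      using U(3) by (intro mult_left_mono) auto
    also have "\<dots> = ennreal ((cmod c)\<^sup>2 * e')"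
      using \<open>e' > 0\<close> by (simp add: ennreal_mult)
    finally have "(dist (to_L2 (\<lambda>t. indicator U t * c)) (to_L2 (\<lambda>t. indicator A t * c)))\<^sup>2
        \<le> (cmod c)\<^sup>2 * e'"
      using \<open>e' > 0\<close> by simp
    also have "(cmod c)\<^sup>2 * e' < e\<^sup>2"
    proof -
      have "(cmod c)\<^sup>2 * e\<^sup>2 < ((cmod c)\<^sup>2 + 1) * e\<^sup>2"
        using that by (intro mult_strict_right_mono) auto
      then show ?thesis
        by (simp add: e'_def pos_divide_less_eq add_nonneg_pos mult.commute)
    qed
    finally have "dist (to_L2 (\<lambda>t. indicator U t * c)) (to_L2 (\<lambda>t. indicator A t * c)) < e"
      using that by (auto intro: power2_less_imp_less)
    then show ?thesis
      using to_L2_indicator_open_in_closure[OF U(1) finU] by blast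
  qed
  then show ?thesis
    by (metis closure_approachable closure_closure)
qed

lemma closure_add_mem:
  fixes K :: "'a::real_normed_vector set"
  assumes "a \<in> closure K" "b \<in> closure K" "\<And>x y. x \<in> K \<Longrightarrow> y \<in> K \<Longrightarrow> x + y \<in> K"
  shows "a + b \<in> closure K"
proof -
  obtain x y where "\<And>n. x n \<in> K" "x \<longlonglongrightarrow> a" "\<And>n. y n \<in> K" "y \<longlonglongrightarrow> b"
    using assms(1,2) by (auto simp: closure_sequential)
  then show ?thesis
    using assms(3) by (auto simp: closure_sequential intro!: exI[of _ "\<lambda>n. x n + y n"] tendsto_add)
qed

lemma continuous_bounded_support_add:
  assumes "f \<in> continuous_bounded_support" "h \<in> continuous_bounded_support"
  shows "(\<lambda>t. f t + h t) \<in> continuous_bounded_support"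
proof -
  obtain R R' where "\<And>t. norm t > R \<Longrightarrow> f t = 0" "\<And>t. norm t > R' \<Longrightarrow> h t = 0"
    using assms by (auto simp: continuous_bounded_support_def)
  then show ?thesis
    using assms by (auto simp: continuous_bounded_support_def
        intro!: continuous_intros exI[of _ "max R R'"])
qed

text \<open>
  A simple function is a finite sum of multiples of indicators of its level sets. Those at nonzero
  values have finite measure because the function is square-integrable.
\<close>
lemma to_L2_simple_function_in_closure:
  fixes s :: "real^'d::finite \<Rightarrow> complex"
  assumes s: "simple_function lborel s" and sq: "square_integrable s"
  shows "to_L2 s \<in> closure (to_L2 ` continuous_bounded_support)" (is "_ \<in> closure ?K")
proof -
  have [measurable]: "s \<in> borel_measurable borel"
    using sq by auto
  define p where "p Y t = (\<Sum>y\<in>Y. indicator (s -` {y}) t * y)" for Y t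
  have K_add: "x + y \<in> ?K" if xy: "x \<in> ?K" "y \<in> ?K" for x y
  proof -
    obtain f h where fh: "f \<in> continuous_bounded_support" "x = to_L2 f"
      "h \<in> continuous_bounded_support" "y = to_L2 h"
      using xy by blast
    then have "x + y = to_L2 (\<lambda>t. f t + h t)"
      by (simp add: add_to_L2 continuous_bounded_support_square_integrable)
    then show ?thesis
      using continuous_bounded_support_add[OF fh(1,3)] by blast
  qed
  have piece: "square_integrable (\<lambda>t. indicator (s -` {y}) t * y) \<and>
      to_L2 (\<lambda>t. indicator (s -` {y}) t * y) \<in> closure ?K" for y
  proof (cases "y = 0")
    case True
    have "to_L2 (\<lambda>_. 0) \<in> ?K"
      by (rule imageI) (simp add: continuous_bounded_support_def)
    then show ?thesis
      using True closure_subset[of ?K] by (auto simp: square_integrable_zero)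
  next
    case False
    have [measurable]: "s -` {y} \<in> sets borel"
      using measurable_sets[of s borel borel "{y}"] by simp
    have "ennreal ((cmod y)\<^sup>2) * emeasure lborel (s -` {y})
        = (\<integral>\<^sup>+t. ennreal ((cmod y)\<^sup>2) * indicator (s -` {y}) t \<partial>lborel)"
      by (simp add: nn_integral_cmult_indicator)
    also have "\<dots> \<le> (\<integral>\<^sup>+t. ennreal ((cmod (s t))\<^sup>2) \<partial>lborel)"
      by (intro nn_integral_mono) (auto simp: indicator_def)
    also have "\<dots> < \<infinity>"
      by (simp add: nn_integral_norm_to_L2 sq)
    finally have fin: "emeasure lborel (s -` {y}) < \<infinity>"
      using False by (auto simp: ennreal_mult_less_top)
    have "square_integrable (\<lambda>t. indicator (s -` {y}) t * y)"
      by (rule square_integrable_dominated[where w="\<lambda>t. cmod (s t)"])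
        (use sq in \<open>auto simp: square_integrable_def indicator_def\<close>)
    then show ?thesis
      using to_L2_indicator_in_closure[OF _ fin] by simp
  qed
  have "square_integrable (p Y) \<and> to_L2 (p Y) \<in> closure ?K" if "finite Y" for Y
    using that
  proof (induction Y)
    case empty
    show ?case using piece[of 0] by (simp add: p_def)
  next
    case (insert y Y)
    have "p (insert y Y) = (\<lambda>t. indicator (s -` {y}) t * y + p Y t)"
      using insert.hyps by (intro ext) (simp only: p_def sum.insert simp_thms)
    then show ?case
      using insert piece[of y] square_integrable_add[of "\<lambda>t. indicator (s -` {y}) t * y" "p Y"]
        closure_add_mem[OF _ _ K_add, of "to_L2 (\<lambda>t. indicator (s -` {y}) t * y)" "to_L2 (p Y)"]
      by (simp add: add_to_L2)
  qed
  moreover have "finite (range s)"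
    using s by (simp add: simple_function_def)
  moreover have "p (range s) = s"
  proof
    fix t
    have "p (range s) t = (\<Sum>y\<in>range s. if y = s t then y else 0)"
      unfolding p_def by (intro sum.cong) (auto simp: indicator_def)
    then show "p (range s) t = s t"
      using \<open>finite (range s)\<close> by simp
  qed
  ultimately show ?thesis
    by metis
qed

theorem continuous_bounded_support_dense_L2:
  "closure (to_L2 ` continuous_bounded_support) = (UNIV :: 'd::finite L2 set)"
proof -
  have "f \<in> closure (to_L2 ` continuous_bounded_support)" for f :: "'d L2"
  proof -
    obtain F where F: "square_integrable F" "f = to_L2 F" by (rule L2_cases)
    then have [measurable]: "F \<in> borel_measurable borel" by auto
    obtain s where s: "\<And>i. simple_function lborel (s i)" "\<And>x. (\<lambda>i. s i x) \<longlonglongrightarrow> F x"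
      "\<And>i x. cmod (s i x) \<le> 2 * cmod (F x)"
      using borel_measurable_implies_sequence_metric[of F lborel 0] by auto
    have m[measurable]: "s i \<in> borel_measurable borel" for i
      using borel_measurable_simple_function[OF s(1)[of i]] by simp
    have w: "integrable lborel (\<lambda>t. (2 * cmod (F t))\<^sup>2)"
      using F by (simp add: square_integrable_def power_mult_distrib)
    have le: "cmod (F x) \<le> 2 * cmod (F x)" for x
      by simp
    have "(\<lambda>i. to_L2 (s i)) \<longlonglongrightarrow> to_L2 F"
      by (rule tendsto_to_L2_dominated[OF _ _ w _ s(3) le s(2)]) auto
    moreover have "to_L2 (s i) \<in> closure (to_L2 ` continuous_bounded_support)" for i
      by (intro to_L2_simple_function_in_closure s(1) square_integrable_dominated[OF _ w s(3)]) auto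
    ultimately show ?thesis
      unfolding F(2) by (rule closed_sequentially[OF closed_closure, rotated])
  qed
  then show ?thesis by auto
qed

section \<open>Translated and dilated wavelets\<close>

lemma nn_integral_lborel_affine:
  fixes f :: "'a::euclidean_space \<Rightarrow> ennreal"
  assumes [measurable]: "f \<in> borel_measurable borel" and c: "c \<noteq> 0"
  shows "(\<integral>\<^sup>+u. f u \<partial>lborel) = ennreal (\<bar>c\<bar> ^ DIM('a)) * (\<integral>\<^sup>+u. f (x + c *\<^sub>R u) \<partial>lborel)"
  by (subst lborel_affine[OF c, of x])
    (simp add: nn_integral_density nn_integral_distr nn_integral_cmult)

text \<open>
  Taking the parameters as a pair makes continuity in \<open>(x, s)\<close> a statement about one function.
\<close>
abbreviation wavelet_atom :: "'d::finite L2 \<Rightarrow> (real^'d) \<times> real \<Rightarrow> 'd L2" where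
  "wavelet_atom g p \<equiv> translate_L2 (fst p) (dilate_L2 (snd p) g)"

definition wavelet_atom_fun :: "(real^'d::finite \<Rightarrow> complex) \<Rightarrow> real^'d \<Rightarrow> real \<Rightarrow> real^'d \<Rightarrow> complex" where
  "wavelet_atom_fun g x s t = complex_of_real (s powr (- (real CARD('d) / 2))) * g (inverse s *\<^sub>R (t - x))"

lemma powr_half_dim_square:
  fixes s :: real assumes "s > 0"
  shows "(s powr (- (real n / 2)))\<^sup>2 * s ^ n = 1"
proof -
  have "(s powr (- (real n / 2)))\<^sup>2 = s powr (- real n)"
    using assms by (simp add: power2_eq_square flip: powr_add)
  then show ?thesis
    using assms by (simp add: powr_minus powr_realpow)
qed

lemma square_integrable_wavelet_atom_fun:
  assumes "square_integrable g" "s > 0"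
  shows "square_integrable (wavelet_atom_fun g x s)"
  unfolding wavelet_atom_fun_def
  using square_integrable_translate[OF square_integrable_dilate[OF assms(1), of "inverse s"], of x] assms
  by (intro square_integrable_cmult) simp

lemma wavelet_atom_to_L2:
  assumes "square_integrable g" "s > 0"
  shows "wavelet_atom (to_L2 g) (x, s) = to_L2 (wavelet_atom_fun g x s)"
  using assms
  by (simp add: dilate_to_L2 translate_to_L2 square_integrable_cmult square_integrable_dilate
      wavelet_atom_fun_def[abs_def])

lemma norm_wavelet_atom:
  fixes g :: "'d::finite L2"
  assumes s: "s > 0"
  shows "norm (wavelet_atom g (x, s)) = norm g"
proof -
  obtain F where F: "square_integrable F" "g = to_L2 F" by (rule L2_cases)
  then have [measurable]: "F \<in> borel_measurable borel" by auto
  have "ennreal ((norm (wavelet_atom g (x, s)))\<^sup>2)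
      = (\<integral>\<^sup>+t. ennreal ((cmod (wavelet_atom_fun F x s t))\<^sup>2) \<partial>lborel)"
    using F s by (simp only: wavelet_atom_to_L2 square_integrable_wavelet_atom_fun nn_integral_norm_to_L2)
  also have "\<dots> = ennreal (\<bar>s\<bar> ^ CARD('d)) * (\<integral>\<^sup>+t. ennreal ((cmod (wavelet_atom_fun F x s (x
      + s *\<^sub>R t)))\<^sup>2) \<partial>lborel)"
    unfolding wavelet_atom_fun_def using s by (subst nn_integral_lborel_affine[of _ s x]) auto
  also have "\<dots> = (\<integral>\<^sup>+t. ennreal ((cmod (F t))\<^sup>2) \<partial>lborel)"
  proof -
    have "s ^ CARD('d) * (cmod (wavelet_atom_fun F x s (x + s *\<^sub>R t)))\<^sup>2 = (cmod (F t))\<^sup>2" for t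
    proof -
      have "s ^ CARD('d) * (cmod (wavelet_atom_fun F x s (x + s *\<^sub>R t)))\<^sup>2
          = ((s powr (- (real CARD('d) / 2)))\<^sup>2 * s ^ CARD('d)) * (cmod (F t))\<^sup>2"
        using s by (simp add: wavelet_atom_fun_def norm_mult power_mult_distrib)
      then show ?thesis
        by (simp only: powr_half_dim_square[OF s] mult_1)
    qed
    then show ?thesis
      using s by (subst nn_integral_cmult[symmetric]) (auto simp: wavelet_atom_fun_def
          simp flip: ennreal_mult)
  qed
  also have "\<dots> = ennreal ((norm g)\<^sup>2)"
    using F by (simp add: nn_integral_norm_to_L2)
  finally show ?thesis
    by simp
qed

lemma wavelet_atom_diff:
  assumes s: "s > 0"
  shows "wavelet_atom (g - h) (x, s) = wavelet_atom g (x, s) - wavelet_atom h (x, s)"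
proof -
  obtain F where F: "square_integrable F" "g = to_L2 F" by (rule L2_cases)
  obtain H where H: "square_integrable H" "h = to_L2 H" by (rule L2_cases)
  show ?thesis
    using F H s
    by (simp only: diff_to_L2 wavelet_atom_to_L2 square_integrable_wavelet_atom_fun square_integrable_diff)
      (simp add: wavelet_atom_fun_def[abs_def] ring_distribs)
qed

lemma dist_wavelet_atom:
  assumes s: "s > 0"
  shows "dist (wavelet_atom g (x, s)) (wavelet_atom h (x, s)) = dist g h"
  using assms by (simp only: dist_norm norm_wavelet_atom flip: wavelet_atom_diff)

text \<open>
  For a continuous function of bounded support, the atoms along a convergent sequence of parameters
  converge pointwise. The parameters stay in a compact subset of the half-space, so the scales are
  bounded away from \<open>0\<close> and all atoms are dominated by one multiple of the indicator of a ball.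
\<close>
lemma tendsto_wavelet_atom_continuous:
  fixes f :: "real^'d::finite \<Rightarrow> complex"
  assumes f: "f \<in> continuous_bounded_support"
    and pq: "p \<longlonglongrightarrow> q" and pos: "\<And>n. snd (p n) > 0" "snd q > 0"
  shows "(\<lambda>n. wavelet_atom (to_L2 f) (p n)) \<longlonglongrightarrow> wavelet_atom (to_L2 f) q"
proof -
  let ?C = "insert q (range p)"
  have C: "compact ?C" using pq by (rule compact_sequence_with_limit)
  have "compact (snd ` ?C)" "snd ` ?C \<noteq> {}"
    using C by (auto intro!: compact_continuous_image continuous_intros simp del: image_insert)
  then obtain a where a: "a \<in> snd ` ?C" "\<And>r. r \<in> ?C \<Longrightarrow> a \<le> snd r"
    by (metis compact_attains_inf imageI)
  then have a0: "a > 0" using pos by auto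
  obtain B where B: "B > 0" "\<And>r. r \<in> ?C \<Longrightarrow> norm r \<le> B"
    using C compact_imp_bounded bounded_pos by metis
  obtain M R where M: "M \<ge> 0" "\<And>t. cmod (f t) \<le> M * indicator (cball 0 R) t"
    using continuous_bounded_support_bound[OF f] by blast
  have cont: "continuous_on UNIV f" using f by (simp add: continuous_bounded_support_def)
  note sq = continuous_bounded_support_square_integrable[OF f]
  define A where "A = a powr (- (real CARD('d) / 2)) * M"
  define R' where "R' = B + B * \<bar>R\<bar>"
  let ?w = "\<lambda>t::real^'d. A * indicator (cball 0 R') t :: real"
  have bound: "cmod (wavelet_atom_fun f (fst r) (snd r) t) \<le> ?w t" if r: "r \<in> ?C" for r t
  proof (cases "norm (inverse (snd r) *\<^sub>R (t - fst r)) \<le> R")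
    case True
    have s: "a \<le> snd r" "snd r \<le> B" "snd r > 0" "norm (fst r) \<le> B"
      using a(2)[OF r] a0 B(2)[OF r] norm_snd_le[of "snd r" "fst r"] norm_fst_le[of "fst r" "snd r"] by auto
    have "norm (t - fst r) \<le> R * snd r"
      using True[unfolded norm_scaleR] s by (simp add: field_simps)
    also have "\<dots> \<le> \<bar>R\<bar> * B"
      using s by (intro mult_mono) auto
    finally have "norm t \<le> B + B * \<bar>R\<bar>"
      using norm_triangle_sub[of t "fst r"] s by (simp add: mult.commute)
    moreover have "snd r powr (- (real CARD('d) / 2)) \<le> a powr (- (real CARD('d) / 2))"
      using s a0 by (intro powr_mono2') auto
    moreover have "cmod (f (inverse (snd r) *\<^sub>R (t - fst r))) \<le> M"
      using M(2)[of "inverse (snd r) *\<^sub>R (t - fst r)"] True by simp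
    ultimately show ?thesis
      using M(1) by (simp add: wavelet_atom_fun_def norm_mult mult_mono A_def R'_def)
  next
    case False
    then have "f (inverse (snd r) *\<^sub>R (t - fst r)) = 0"
      using M(2)[of "inverse (snd r) *\<^sub>R (t - fst r)"] by simp
    then show ?thesis
      using M(1) by (simp add: wavelet_atom_fun_def A_def)
  qed
  have meas: "wavelet_atom_fun f (fst r) (snd r) \<in> borel_measurable borel" for r
    using continuous_bounded_support_measurable[OF f] unfolding wavelet_atom_fun_def by simp
  have "(\<lambda>n. to_L2 (wavelet_atom_fun f (fst (p n)) (snd (p n))))
      \<longlonglongrightarrow> to_L2 (wavelet_atom_fun f (fst q) (snd q))"
  proof (rule tendsto_to_L2_dominated[where w="?w"])
    show "?w \<in> borel_measurable borel"
      by (intro borel_measurable_times borel_measurable_const borel_measurable_indicator) simp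
    fix t
    show "cmod (wavelet_atom_fun f (fst (p n)) (snd (p n)) t) \<le> ?w t" for n
      by (rule bound) simp
    show "cmod (wavelet_atom_fun f (fst q) (snd q) t) \<le> ?w t"
      by (rule bound) simp
    have "(\<lambda>n. inverse (snd (p n)) *\<^sub>R (t - fst (p n))) \<longlonglongrightarrow> inverse (snd q) *\<^sub>R (t - fst q)"
      using pos by (intro tendsto_intros pq) auto
    from continuous_on_tendsto_compose[OF cont this]
    show "(\<lambda>n. wavelet_atom_fun f (fst (p n)) (snd (p n)) t) \<longlonglongrightarrow> wavelet_atom_fun f (fst q) (snd q) t"
      unfolding wavelet_atom_fun_def using pos by (intro tendsto_intros pq) auto
  qed (rule meas integrable_const_on_cball)+
  then show ?thesis
    using wavelet_atom_to_L2[OF sq pos(1)] wavelet_atom_to_L2[OF sq pos(2)] by simp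
qed

text \<open>
  Each map \<open>g \<mapsto> T\<^sub>x D\<^sub>s g\<close> is an isometry, so the continuity just shown on a dense set extends
  to all of \<open>L\<^sup>2\<close> by an argument with three errors.
\<close>
theorem continuous_on_wavelet_atom:
  "continuous_on (UNIV \<times> {0<..}) (wavelet_atom (g :: 'd::finite L2))"
proof (rule continuous_on_sequentiallyI)
  fix p :: "nat \<Rightarrow> (real^'d) \<times> real" and q
  assume "\<forall>n. p n \<in> UNIV \<times> {0<..}" "q \<in> UNIV \<times> {0<..}" and pq: "p \<longlonglongrightarrow> q"
  then have pos: "\<And>n. snd (p n) > 0" "snd q > 0"
    by (auto simp: mem_Times_iff)
  show "(\<lambda>n. wavelet_atom g (p n)) \<longlonglongrightarrow> wavelet_atom g q"
  proof (rule metric_LIMSEQ_I)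
    fix e :: real assume "e > 0"
    have "g \<in> closure (to_L2 ` continuous_bounded_support)"
      by (simp add: continuous_bounded_support_dense_L2)
    then obtain f where f: "f \<in> continuous_bounded_support" "dist (to_L2 f) g < e / 3"
      using \<open>e > 0\<close> unfolding closure_approachable by (metis divide_pos_pos imageE zero_less_numeral)
    have "\<forall>\<^sub>F n in sequentially. dist (wavelet_atom (to_L2 f) (p n)) (wavelet_atom (to_L2 f) q) < e / 3"
      using tendsto_wavelet_atom_continuous[OF f(1) pq pos] \<open>e > 0\<close> by (intro tendstoD) auto
    then obtain N where N: "\<And>n. n \<ge> N \<Longrightarrow> dist (wavelet_atom (to_L2 f) (p n)) (wavelet_atom (to_L2 f) q)
        < e / 3"
      by (auto simp: eventually_sequentially)
    have "dist (wavelet_atom g (p n)) (wavelet_atom g q) < e" if "n \<ge> N" for n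
    proof -
      have "dist (wavelet_atom g (p n)) (wavelet_atom (to_L2 f) (p n)) < e / 3"
        "dist (wavelet_atom (to_L2 f) q) (wavelet_atom g q) < e / 3"
        using f(2) dist_wavelet_atom[OF pos(1)[of n], where g=g and h="to_L2 f" and x="fst (p n)"]
          dist_wavelet_atom[OF pos(2), where g="to_L2 f" and h=g and x="fst q"]
              by (simp_all add: dist_commute)
      then show ?thesis
        using N[OF that] dist_triangle_third by blast
    qed
    then show "\<exists>N. \<forall>n\<ge>N. dist (wavelet_atom g (p n)) (wavelet_atom g q) < e"
      by blast
  qed
qed

section \<open>The Fourier transform of integrable functions\<close>

definition plane_wave :: "real^'d::finite \<Rightarrow> real^'d \<Rightarrow> complex" where
  "plane_wave \<omega> t = exp (- (2 * pi * \<i> * complex_of_real (\<omega> \<bullet> t)))"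

lemma fourier_eq: "fourier f \<omega> = (\<integral>t. f t * plane_wave \<omega> t \<partial>lborel)"
  by (simp add: fourier_def plane_wave_def)

lemma norm_plane_wave [simp]: "cmod (plane_wave \<omega> t) = 1"
  by (simp add: plane_wave_def norm_exp_eq_Re)

lemma plane_wave_zero [simp]: "plane_wave 0 t = 1"
  by (simp add: plane_wave_def)

lemma plane_wave_commute: "plane_wave \<omega> t = plane_wave t \<omega>"
  by (simp add: plane_wave_def inner_commute)

lemma plane_wave_diff: "plane_wave \<omega> (t - u) = plane_wave \<omega> t * cnj (plane_wave \<omega> u)"
  by (simp add: plane_wave_def exp_cnj inner_diff_right ring_distribs flip: exp_add)

lemma plane_wave_scaleR: "plane_wave (c *\<^sub>R \<omega>) t = plane_wave \<omega> (c *\<^sub>R t)"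
  by (simp add: plane_wave_def)

lemma plane_wave_measurable [measurable]:
  assumes [measurable]: "f \<in> borel_measurable M" "g \<in> borel_measurable M"
  shows "(\<lambda>x. plane_wave (f x) (g x)) \<in> borel_measurable M"
  unfolding plane_wave_def by measurable

lemma integrable_times_plane_wave:
  assumes "integrable lborel f"
  shows "integrable lborel (\<lambda>t. f t * plane_wave \<omega> t)"
proof (rule Bochner_Integration.integrable_bound[OF assms])
  have [measurable]: "f \<in> borel_measurable borel" using assms by auto
  show "(\<lambda>t. f t * plane_wave \<omega> t) \<in> borel_measurable lborel" by measurable
qed (simp add: norm_mult)

lemma norm_fourier_le:
  assumes "integrable lborel f"
  shows "cmod (fourier f \<omega>) \<le> (\<integral>t. cmod (f t) \<partial>lborel)"
  unfolding fourier_eq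
  by (rule order_trans[OF integral_norm_bound]) (simp add: norm_mult)

lemma borel_measurable_fourier:
  assumes [measurable]: "f \<in> borel_measurable borel"
  shows "fourier f \<in> borel_measurable borel"
proof -
  have "(\<lambda>\<omega>. \<integral>t. f t * plane_wave \<omega> t \<partial>lborel) \<in> borel_measurable borel"
    by measurable
  then show ?thesis by (simp add: fourier_eq[abs_def])
qed

lemma fourier_diff:
  assumes "integrable lborel f" "integrable lborel g"
  shows "fourier (\<lambda>t. f t - g t) \<omega> = fourier f \<omega> - fourier g \<omega>"
  using assms by (simp add: fourier_eq left_diff_distrib integrable_times_plane_wave)

lemma integrable_lborel_affine:
  fixes f :: "'a::euclidean_space \<Rightarrow> 'b::{banach, second_countable_topology}"
  assumes f: "integrable lborel f" and c: "c \<noteq> 0"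
  shows "integrable lborel (\<lambda>u. f (x + c *\<^sub>R u))"
proof -
  have [measurable]: "f \<in> borel_measurable borel" using f by auto
  have "(\<integral>\<^sup>+u. norm (f u) \<partial>lborel) < \<infinity>"
    using f by (simp add: integrable_iff_bounded)
  then show ?thesis
    unfolding nn_integral_lborel_affine[OF _ c, of "\<lambda>u. ennreal (norm (f u))" x, simplified]
    using c by (auto simp: integrable_iff_bounded ennreal_mult_less_top)
qed

lemma integral_lborel_affine:
  fixes f :: "'a::euclidean_space \<Rightarrow> 'b::{banach, second_countable_topology}"
  assumes [measurable]: "f \<in> borel_measurable borel" and c: "c \<noteq> 0"
  shows "(\<integral>u. f u \<partial>lborel) = \<bar>c\<bar> ^ DIM('a) *\<^sub>R (\<integral>u. f (x + c *\<^sub>R u) \<partial>lborel)"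
  by (subst lborel_affine[OF c, of x]) (simp add: integral_density integral_distr)

text \<open>
  The dilation is written \<open>inverse s\<close> because this is how it occurs in the wavelet atoms.
\<close>
lemma fourier_dilate:
  fixes f :: "real^'d::finite \<Rightarrow> complex"
  assumes [measurable]: "f \<in> borel_measurable borel" and s: "s > 0"
  shows "fourier (\<lambda>t. f (inverse s *\<^sub>R t)) \<omega> = of_real (s ^ CARD('d)) * fourier f (s *\<^sub>R \<omega>)"
  unfolding fourier_eq plane_wave_scaleR
  using s by (subst integral_lborel_affine[of _ s 0]) (auto simp: scaleR_conv_of_real[where 'a=complex])

text \<open>
  For \<open>g\<close> an atom at position \<open>0\<close> and scale \<open>s\<close> this is \<open>x \<mapsto> W\<^sub>g f (x, s)\<close>, and for \<open>f = g\<close> it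
  is the autocorrelation, which drives the proof of Plancherel's theorem.
\<close>
definition correlate :: "(real^'d::finite \<Rightarrow> complex) \<Rightarrow> (real^'d \<Rightarrow> complex) \<Rightarrow> real^'d \<Rightarrow> complex" where
  "correlate f g x = (\<integral>t. f t * cnj (g (t - x)) \<partial>lborel)"

lemma integrable_correlate_kernel:
  fixes f g :: "real^'d::finite \<Rightarrow> complex"
  assumes f: "integrable lborel f" and g: "integrable lborel g"
  shows "integrable (lborel \<Otimes>\<^sub>M lborel) (\<lambda>(t, x). f t * cnj (g (t - x)))"
proof -
  have [measurable]: "f \<in> borel_measurable borel" "g \<in> borel_measurable borel"
    using f g by auto
  have gt: "integrable lborel (\<lambda>x. g (t - x))" for t
    using integrable_lborel_affine[OF g, of "-1" t] by simp
  have gt_eq: "(\<integral>x. cmod (g (t - x)) \<partial>lborel) = (\<integral>x. cmod (g x) \<partial>lborel)" for t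
    by (subst (2) integral_lborel_affine[of _ "-1" t]) auto
  show ?thesis
  proof (rule lborel_pair.Fubini_integrable)
    show "integrable lborel (\<lambda>t. \<integral>x. norm (case (t, x) of (t, x) \<Rightarrow> f t * cnj (g (t - x))) \<partial>lborel)"
      using f by (simp add: norm_mult gt_eq)
    show "AE t in lborel. integrable lborel (\<lambda>x. case (t, x) of (t, x) \<Rightarrow> f t * cnj (g (t - x)))"
      using gt by simp
  qed measurable
qed

lemma integrable_correlate:
  assumes f: "integrable lborel f" and g: "integrable lborel g"
  shows "integrable lborel (correlate f g)"
  unfolding correlate_def[abs_def]
  by (rule lborel_pair.integrable_snd[OF integrable_correlate_kernel[OF assms]])

text \<open>
  After an exchange of integrals, the substitution \<open>u = t - x\<close> factors the plane wave
  \<open>e\<^sub>\<omega>(t - u) = e\<^sub>\<omega>(t) \<cdot> cnj (e\<^sub>\<omega>(u))\<close>.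
\<close>
theorem fourier_correlate:
  fixes f g :: "real^'d::finite \<Rightarrow> complex"
  assumes f: "integrable lborel f" and g: "integrable lborel g"
  shows "fourier (correlate f g) \<omega> = fourier f \<omega> * cnj (fourier g \<omega>)"
proof -
  have [measurable]: "f \<in> borel_measurable borel" "g \<in> borel_measurable borel"
    using f g by auto
  have "integrable (lborel \<Otimes>\<^sub>M lborel) (\<lambda>(t, x). f t * cnj (g (t - x)) * plane_wave \<omega> x)"
    by (rule Bochner_Integration.integrable_bound[OF integrable_correlate_kernel[OF assms]])
      (auto simp: norm_mult)
  note Fubini = lborel_pair.Fubini_integral[OF this]
  have inner: "(\<integral>x. f t * cnj (g (t - x)) * plane_wave \<omega> x \<partial>lborel)
      = f t * plane_wave \<omega> t * cnj (fourier g \<omega>)" for t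
  proof -
    have "(\<integral>x. f t * cnj (g (t - x)) * plane_wave \<omega> x \<partial>lborel)
        = (\<integral>u. f t * cnj (g u) * plane_wave \<omega> (t - u) \<partial>lborel)"
      by (subst integral_lborel_affine[of _ "-1" t]) auto
    also have "\<dots> = (\<integral>u. (f t * plane_wave \<omega> t) * cnj (g u * plane_wave \<omega> u) \<partial>lborel)"
      by (simp add: plane_wave_diff mult_ac)
    also have "\<dots> = f t * plane_wave \<omega> t * cnj (fourier g \<omega>)"
      unfolding fourier_eq by (subst integral_mult_right_zero) (simp only: Bochner_Integration.integral_cnj)
    finally show ?thesis .
  qed
  have "fourier (correlate f g) \<omega> = (\<integral>x. (\<integral>t. f t * cnj (g (t - x)) * plane_wave \<omega> x \<partial>lborel) \<partial>lborel)"
    by (simp add: fourier_eq correlate_def)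
  also have "\<dots> = (\<integral>t. (\<integral>x. f t * cnj (g (t - x)) * plane_wave \<omega> x \<partial>lborel) \<partial>lborel)"
    by (rule Fubini)
  also have "\<dots> = fourier f \<omega> * cnj (fourier g \<omega>)"
    by (simp add: inner fourier_eq)
  finally show ?thesis .
qed

theorem fourier_multiplication_formula:
  fixes f g :: "real^'d::finite \<Rightarrow> complex"
  assumes f: "integrable lborel f" and g: "integrable lborel g"
  shows "(\<integral>x. fourier f x * g x \<partial>lborel) = (\<integral>x. f x * fourier g x \<partial>lborel)"
proof -
  have [measurable]: "f \<in> borel_measurable borel" "g \<in> borel_measurable borel"
    using f g by auto
  have "integrable (lborel \<Otimes>\<^sub>M lborel) (\<lambda>(x, y). f x * g y * plane_wave x y)"
  proof (rule lborel_pair.Fubini_integrable)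
    show "integrable lborel (\<lambda>x. \<integral>y. norm (case (x, y) of (x, y) \<Rightarrow> f x * g y * plane_wave x y) \<partial>lborel)"
      using f by (simp add: norm_mult)
    show "AE x in lborel. integrable lborel (\<lambda>y. case (x, y) of (x, y) \<Rightarrow> f x * g y * plane_wave x y)"
      using integrable_mult_right[OF integrable_times_plane_wave[OF g]] by (simp add: mult.assoc)
  qed measurable
  note Fubini = lborel_pair.Fubini_integral[OF this]
  have "(\<integral>y. fourier f y * g y \<partial>lborel) = (\<integral>y. (\<integral>x. f x * g y * plane_wave x y \<partial>lborel) \<partial>lborel)"
    unfolding fourier_eq
    by (subst integral_mult_left_zero[symmetric])
      (intro Bochner_Integration.integral_cong refl, simp add: plane_wave_commute mult_ac)
  also have "\<dots> = (\<integral>x. (\<integral>y. f x * g y * plane_wave x y \<partial>lborel) \<partial>lborel)"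
    by (rule Fubini)
  also have "\<dots> = (\<integral>x. f x * fourier g x \<partial>lborel)"
    by (simp add: fourier_eq mult.assoc)
  finally show ?thesis .
qed

section \<open>Gaussians\<close>

lemma has_bochner_integral_lborel_prod:
  fixes f :: "'a::euclidean_space \<Rightarrow> real \<Rightarrow> 'b::{real_normed_field, banach, second_countable_topology}"
  assumes f: "\<And>b. b \<in> Basis \<Longrightarrow> integrable lborel (f b)"
  shows "has_bochner_integral lborel (\<lambda>x. \<Prod>b\<in>Basis. f b (x \<bullet> b)) (\<Prod>b\<in>Basis. integral\<^sup>L lborel (f b))"
proof -
  interpret product_sigma_finite "\<lambda>_::'a. lborel :: real measure"
    by (simp add: product_sigma_finite_def lborel.sigma_finite_measure_axioms)
  have [measurable]: "f b \<in> borel_measurable borel" if "b \<in> Basis" for b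
    using f[OF that] by auto
  have "has_bochner_integral (\<Pi>\<^sub>M b\<in>Basis. lborel) (\<lambda>y. \<Prod>b\<in>Basis. f b (y b)) (\<Prod>b\<in>Basis. integral\<^sup>L
      lborel (f b))"
    using f by (simp add: has_bochner_integral_iff product_integrable_prod product_integral_prod)
  also have "(\<lambda>y. \<Prod>b\<in>Basis. f b (y b)) = (\<lambda>y. \<Prod>b\<in>Basis. f b ((\<Sum>b\<in>Basis. y b *\<^sub>R b) \<bullet> b))"
    by (intro ext prod.cong refl arg_cong2[where f=f]) (simp add: inner_sum_left inner_Basis
        if_distrib sum.delta cong: if_cong)
  finally show ?thesis
    by (subst lborel_eq, subst has_bochner_integral_distr) auto
qed

lemma integrable_gauss_1D: "integrable lborel (\<lambda>u::real. exp (- (pi * u\<^sup>2)))"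
proof -
  have "integrable lborel (\<lambda>u. sqrt (2 * pi) * std_normal_density (0 + sqrt (2 * pi) * u))"
    by (intro integrable_mult_right lborel_integrable_real_affine integrable_normal_density) auto
  then show ?thesis
    by (simp add: std_normal_density_def power_mult_distrib)
qed

text \<open>
  The characteristic function of the standard normal distribution, after rescaling the variable by
  \<open>sqrt (2 * pi)\<close>.
\<close>
lemma integral_gauss_plane_wave_1D:
  "(\<integral>u. exp (- (pi * (u::real)\<^sup>2)) * exp (- (2 * pi * \<i> * complex_of_real (w * u))) \<partial>lborel)
    = exp (- (pi * w\<^sup>2))"
proof -
  define c where "c = sqrt (2 * pi)"
  have c: "c > 0" "c\<^sup>2 = 2 * pi" by (simp_all add: c_def)
  have "complex_of_real (exp (- ((- c * w)\<^sup>2) / 2)) = char std_normal_distribution (- c * w)"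
    by (simp add: char_std_normal_distribution)
  also have "\<dots> = (\<integral>x. std_normal_density x *\<^sub>R iexp (- c * w * x) \<partial>lborel)"
    unfolding char_def by (subst integral_density) auto
  also have "\<dots> = \<bar>c\<bar> *\<^sub>R (\<integral>u. std_normal_density (0 + c * u) *\<^sub>R iexp (- c * w * (0 + c * u)) \<partial>lborel)"
    using c by (intro lborel_integral_real_affine) auto
  also have "\<dots> = (\<integral>u. complex_of_real (c * std_normal_density (c * u)) * iexp (- c * w * (c * u)) \<partial>lborel)"
    using c by (simp add: scaleR_conv_of_real[where 'a=complex] mult.assoc flip: integral_mult_right_zero)
  also have "\<dots> = (\<integral>u. exp (- (pi * u\<^sup>2)) * exp (- (2 * pi * \<i> * complex_of_real (w * u))) \<partial>lborel)"
  proof (intro Bochner_Integration.integral_cong refl arg_cong2[where f="(*)"] arg_cong[where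
      f=complex_of_real])
    fix u
    show "c * std_normal_density (c * u) = exp (- (pi * u\<^sup>2))"
      using c by (simp add: std_normal_density_def power_mult_distrib c_def)
    have "- c * w * (c * u) = - (c\<^sup>2 * (w * u))"
      by (simp add: power2_eq_square)
    then have "- c * w * (c * u) = - (2 * pi * (w * u))"
      by (simp only: c)
    then show "iexp (- c * w * (c * u)) = exp (- (2 * pi * \<i> * complex_of_real (w * u)))"
      by (simp only:) (simp add: mult_ac)
  qed
  also have "- ((- c * w)\<^sup>2) / 2 = - (pi * w\<^sup>2)"
    using c by (simp add: power_mult_distrib)
  finally show ?thesis
    by simp
qed

text \<open>
  The factor \<open>pi\<close> makes this Gaussian its own Fourier transform and its integral \<open>1\<close>.
\<close>
definition gauss :: "real^'d::finite \<Rightarrow> real" where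
  "gauss t = exp (- (pi * (norm t)\<^sup>2))"

lemma gauss_measurable [measurable]: "gauss \<in> borel_measurable borel"
  unfolding gauss_def by measurable

lemma gauss_nonneg [simp]: "gauss t \<ge> 0"
  by (simp add: gauss_def)

lemma gauss_prod: "gauss t = (\<Prod>b\<in>Basis. exp (- (pi * (t \<bullet> b)\<^sup>2)))"
proof -
  have "(norm t)\<^sup>2 = (\<Sum>b\<in>Basis. (t \<bullet> b)\<^sup>2)"
    unfolding power2_norm_eq_inner by (subst euclidean_inner) (simp add: power2_eq_square)
  then show ?thesis
    by (simp add: gauss_def exp_sum sum_distrib_left flip: sum_negf)
qed

lemma integrable_gauss: "integrable lborel (gauss :: real^'d::finite \<Rightarrow> real)"
  unfolding gauss_prod[abs_def]
  using has_bochner_integral_lborel_prod[where 'a="real^'d"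
      and f="\<lambda>_ u. exp (- (pi * u\<^sup>2))"] integrable_gauss_1D
  by (simp add: has_bochner_integral_iff)

text \<open>
  Both the Gaussian and the plane wave are products over the coordinates.
\<close>
theorem fourier_gauss: "fourier (\<lambda>t. complex_of_real (gauss t)) \<omega> = complex_of_real (gauss \<omega>)"
proof -
  let ?h = "\<lambda>b u. exp (- (pi * u\<^sup>2)) * exp (- (2 * pi * \<i> * complex_of_real ((\<omega> \<bullet> b) * u)))"
  have "integrable lborel (\<lambda>u. complex_of_real (exp (- (pi * u\<^sup>2))) * exp (- (2 * pi * \<i>
      * complex_of_real (w * u))))" for w
    by (rule Bochner_Integration.integrable_bound[OF integrable_gauss_1D]) (auto simp: norm_mult
        norm_exp_eq_Re)
  then have "has_bochner_integral lborel (\<lambda>t. \<Prod>b\<in>Basis. ?h b (t \<bullet> b)) (\<Prod>b\<in>Basis. integral\<^sup>L lborel (?h b))"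
    by (intro has_bochner_integral_lborel_prod)
  moreover have "(\<Prod>b\<in>Basis. ?h b (t \<bullet> b)) = complex_of_real (gauss t) * plane_wave \<omega> t" for t
  proof -
    have "plane_wave \<omega> t = exp (\<Sum>b\<in>Basis. - (2 * pi * \<i> * complex_of_real ((\<omega> \<bullet> b) * (t \<bullet> b))))"
      unfolding plane_wave_def euclidean_inner[of \<omega> t] by (simp add: sum_distrib_left sum_negf)
    also have "\<dots> = (\<Prod>b\<in>Basis. exp (- (2 * pi * \<i> * complex_of_real ((\<omega> \<bullet> b) * (t \<bullet> b)))))"
      by (rule exp_sum) simp
    finally show ?thesis
      by (simp only: gauss_prod prod.distrib of_real_prod)
  qed
  ultimately show ?thesis
    by (simp only: fourier_eq has_bochner_integral_integral_eq integral_gauss_plane_wave_1D)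
      (simp add: gauss_prod)
qed

lemma fourier_gauss_dilate:
  fixes \<omega> :: "real^'d::finite"
  assumes "r > 0"
  shows "fourier (\<lambda>t. complex_of_real (gauss (r *\<^sub>R t))) \<omega>
    = complex_of_real (inverse r ^ CARD('d) * gauss (inverse r *\<^sub>R \<omega>))"
  using fourier_dilate[of "\<lambda>t. complex_of_real (gauss t)" "inverse r" \<omega>] assms
  by (simp add: fourier_gauss)

lemma integral_gauss_average:
  fixes a :: "real^'d::finite \<Rightarrow> complex"
  assumes "a \<in> borel_measurable borel" and r: "r > 0"
  shows "(\<integral>y. a y * complex_of_real (inverse r ^ CARD('d) * gauss (inverse r *\<^sub>R y)) \<partial>lborel)
    = (\<integral>z. a (r *\<^sub>R z) * complex_of_real (gauss z) \<partial>lborel)"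
proof -
  have [measurable]: "a \<in> borel_measurable borel" by fact
  have "(\<integral>y. a y * complex_of_real (inverse r ^ CARD('d) * gauss (inverse r *\<^sub>R y)) \<partial>lborel)
    = r ^ CARD('d) *\<^sub>R (\<integral>z. a (r *\<^sub>R z) * complex_of_real (inverse r ^ CARD('d) * gauss z) \<partial>lborel)"
    using r by (subst integral_lborel_affine[of _ r 0]) auto
  also have "\<dots> = (\<integral>z. a (r *\<^sub>R z) * complex_of_real (gauss z) \<partial>lborel)"
  proof -
    have "complex_of_real (r ^ CARD('d)) * (a (r *\<^sub>R z) * complex_of_real (inverse r ^ CARD('d) * gauss z))
        = a (r *\<^sub>R z) * complex_of_real (gauss z)" for z
      using r by (simp add: field_simps)
    then show ?thesis
      by (simp only: scaleR_conv_of_real[where 'a=complex] flip: integral_mult_right_zero)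
  qed
  finally show ?thesis .
qed

lemma integral_gauss: "integral\<^sup>L lborel gauss = 1"
  using fourier_gauss[of 0] by (simp add: fourier_eq gauss_def[of 0])

text \<open>
  Gaussians of width \<open>r\<^sub>n \<rightarrow> 0\<close> form an approximate identity; with the average written in the
  rescaled variable, this is dominated convergence.
\<close>
lemma tendsto_gauss_average:
  fixes a :: "real^'d::finite \<Rightarrow> complex"
  assumes a: "continuous_on UNIV a" "\<And>y. cmod (a y) \<le> C"
    and r: "r \<longlonglongrightarrow> 0"
  shows "(\<lambda>n. \<integral>z. a (r n *\<^sub>R z) * complex_of_real (gauss z) \<partial>lborel) \<longlonglongrightarrow> a 0"
proof -
  have [measurable]: "a \<in> borel_measurable borel"
    using a by (intro borel_measurable_continuous_onI)
  have "(\<lambda>n. \<integral>z. a (r n *\<^sub>R z) * complex_of_real (gauss z) \<partial>lborel)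
      \<longlonglongrightarrow> (\<integral>z. a 0 * complex_of_real (gauss (z :: real^'d)) \<partial>lborel)"
  proof (rule integral_dominated_convergence[where w="\<lambda>z::real^'d. C * gauss z"])
    show "integrable lborel (\<lambda>z::real^'d. C * gauss z)"
      by (intro integrable_mult_right integrable_gauss)
    show "AE z in lborel. (\<lambda>n. a (r n *\<^sub>R z) * complex_of_real (gauss z)) \<longlonglongrightarrow> a 0 * complex_of_real (gauss z)"
    proof
      fix z :: "real^'d"
      have "(\<lambda>n. r n *\<^sub>R z) \<longlonglongrightarrow> 0 *\<^sub>R z"
        by (intro tendsto_intros r)
      then have "(\<lambda>n. a (r n *\<^sub>R z)) \<longlonglongrightarrow> a (0 *\<^sub>R z)"
        by (rule continuous_on_tendsto_compose[OF a(1)]) auto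
      then show "(\<lambda>n. a (r n *\<^sub>R z) * complex_of_real (gauss z)) \<longlonglongrightarrow> a 0 * complex_of_real (gauss z)"
        by (intro tendsto_intros) simp
    qed
    show "AE z in lborel. norm (a (r n *\<^sub>R z) * complex_of_real (gauss z)) \<le> C * gauss z" for n
      using a(2) by (simp add: norm_mult mult_right_mono)
  qed measurable
  then show ?thesis
    by (simp add: integral_gauss)
qed

section \<open>Plancherel's theorem\<close>

lemma correlate_eq_cinner:
  assumes "square_integrable f" "square_integrable g"
  shows "correlate f g x = cinner_L2 (to_L2 f) (translate_L2 x (to_L2 g))"
  using assms by (simp add: translate_to_L2 cinner_to_L2 square_integrable_translate correlate_def)

text \<open>
  Translations are atoms of scale \<open>1\<close>.
\<close>
lemma norm_translate_L2: "norm (translate_L2 x g) = norm g"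
  and continuous_on_translate_L2: "continuous_on UNIV (\<lambda>x. translate_L2 x g)"
proof -
  have 1: "dilate_L2 1 g = g"
    by (rule L2_cases[of g]) (simp add: dilate_to_L2)
  show "norm (translate_L2 x g) = norm g"
    using norm_wavelet_atom[of 1, where g=g and x=x] by (simp add: 1)
  have "continuous_on UNIV (\<lambda>x. wavelet_atom g (x, 1))"
    by (intro continuous_on_compose2[OF continuous_on_wavelet_atom]) (auto intro!: continuous_intros)
  then show "continuous_on UNIV (\<lambda>x. translate_L2 x g)"
    by (simp add: 1)
qed

lemma norm_correlate_le:
  assumes "square_integrable f" "square_integrable g"
  shows "cmod (correlate f g x) \<le> norm (to_L2 f) * norm (to_L2 g)"
  using assms norm_cinner_L2_le[of "to_L2 f" "translate_L2 x (to_L2 g)"]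
  by (simp add: correlate_eq_cinner norm_translate_L2)

lemma continuous_on_correlate:
  assumes "square_integrable f" "square_integrable g"
  shows "continuous_on UNIV (correlate f g)"
  using continuous_on_translate_L2[of "to_L2 g"]
  unfolding continuous_on_def correlate_eq_cinner[OF assms, abs_def]
  by (auto intro: tendsto_cinner_L2)

text \<open>
  By the multiplication formula, the integral of \<open>\<bar>f\<^sup>^\<bar>\<^sup>2\<close>, the transform of the autocorrelation
  \<open>a\<close>, against the Gaussian \<open>gauss (r \<cdot> x)\<close> equals an average of \<open>a\<close> over a Gaussian of width \<open>r\<close>.
  As \<open>r\<close> decreases to \<open>0\<close>, the former increases to the integral of \<open>\<bar>f\<^sup>^\<bar>\<^sup>2\<close> and the latter tends
  to \<open>a 0 = \<parallel>f\<parallel>\<^sup>2\<close>. That the integral is finite is part of the conclusion.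
\<close>
theorem Plancherel:
  fixes f :: "real^'d::finite \<Rightarrow> complex"
  assumes f: "integrable lborel f" "square_integrable f"
  shows "(\<integral>\<^sup>+\<omega>. ennreal ((cmod (fourier f \<omega>))\<^sup>2) \<partial>lborel) = ennreal ((norm (to_L2 f))\<^sup>2)"
proof -
  have [measurable]: "f \<in> borel_measurable borel" "fourier f \<in> borel_measurable borel"
    using f borel_measurable_fourier by auto
  define r where "r n = inverse (real (Suc n))" for n
  have r: "r n > 0" "r (Suc n) \<le> r n" for n
    by (auto simp: r_def field_simps)
  have r0: "r \<longlonglongrightarrow> 0"
    unfolding r_def by (rule LIMSEQ_inverse_real_of_nat)
  let ?a = "correlate f f"
  have a: "continuous_on UNIV ?a" "?a \<in> borel_measurable borel" "integrable lborel ?a"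
    using f by (auto intro!: continuous_on_correlate borel_measurable_continuous_onI integrable_correlate)
  have int: "integrable lborel (\<lambda>x. (cmod (fourier f x))\<^sup>2 * gauss (r n *\<^sub>R x))" for n
  proof (rule Bochner_Integration.integrable_bound)
    show "integrable lborel (\<lambda>x. (\<integral>t. cmod (f t) \<partial>lborel)\<^sup>2 * gauss (r n *\<^sub>R x))"
      using integrable_lborel_affine[OF integrable_gauss, of "r n" 0] r(1)[of n]
      by (intro integrable_mult_right) auto
    have "(cmod (fourier f x))\<^sup>2 * gauss (r n *\<^sub>R x) \<le> (\<integral>t. cmod (f t) \<partial>lborel)\<^sup>2 * gauss (r n *\<^sub>R x)" for x
      by (intro mult_right_mono power_mono norm_fourier_le f) auto
    then show "AE x in lborel. norm ((cmod (fourier f x))\<^sup>2 * gauss (r n *\<^sub>R x))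
        \<le> norm ((\<integral>t. cmod (f t) \<partial>lborel)\<^sup>2 * gauss (r n *\<^sub>R x))"
      by simp
  qed measurable
  have smoothed: "complex_of_real (\<integral>x. (cmod (fourier f x))\<^sup>2 * gauss (r n *\<^sub>R x) \<partial>lborel)
      = (\<integral>z. ?a (r n *\<^sub>R z) * complex_of_real (gauss z) \<partial>lborel)" for n
  proof -
    have "complex_of_real (\<integral>x. (cmod (fourier f x))\<^sup>2 * gauss (r n *\<^sub>R x) \<partial>lborel)
        = (\<integral>x. fourier ?a x * complex_of_real (gauss (r n *\<^sub>R x)) \<partial>lborel)"
      using f by (simp add: fourier_correlate complex_norm_square[symmetric] flip: integral_complex_of_real)
    also have "\<dots> = (\<integral>x. ?a x * fourier (\<lambda>x. complex_of_real (gauss (r n *\<^sub>R x))) x \<partial>lborel)"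
      using integrable_lborel_affine[OF integrable_gauss, of "r n" 0] r(1)[of n] a(3)
      by (intro fourier_multiplication_formula) auto
    also have "\<dots> = (\<integral>z. ?a (r n *\<^sub>R z) * complex_of_real (gauss z) \<partial>lborel)"
      using integral_gauss_average[OF a(2) r(1)] by (simp add: fourier_gauss_dilate r)
    finally show ?thesis .
  qed
  have "?a 0 = complex_of_real ((norm (to_L2 f))\<^sup>2)"
    using correlate_eq_cinner[OF f(2) f(2), of 0] cinner_L2_self[of "to_L2 f"] f(2)
    by (simp add: translate_to_L2)
  then have "(\<lambda>n. complex_of_real (\<integral>x. (cmod (fourier f x))\<^sup>2 * gauss (r n *\<^sub>R x) \<partial>lborel))
      \<longlonglongrightarrow> complex_of_real ((norm (to_L2 f))\<^sup>2)"
    unfolding smoothed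
    using tendsto_gauss_average[OF a(1) norm_correlate_le[OF f(2) f(2)] r0] by simp
  then have "(\<lambda>n. ennreal (\<integral>x. (cmod (fourier f x))\<^sup>2 * gauss (r n *\<^sub>R x) \<partial>lborel))
      \<longlonglongrightarrow> ennreal ((norm (to_L2 f))\<^sup>2)"
    by (intro tendsto_ennrealI) (simp only: tendsto_of_real_iff)
  moreover have "ennreal (\<integral>x. (cmod (fourier f x))\<^sup>2 * gauss (r n *\<^sub>R x) \<partial>lborel)
      = (\<integral>\<^sup>+x. ennreal ((cmod (fourier f x))\<^sup>2 * gauss (r n *\<^sub>R x)) \<partial>lborel)" for n
    using int by (intro nn_integral_eq_integral[symmetric]) auto
  moreover have "(\<lambda>n. \<integral>\<^sup>+x. ennreal ((cmod (fourier f x))\<^sup>2 * gauss (r n *\<^sub>R x)) \<partial>lborel)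
      \<longlonglongrightarrow> (\<integral>\<^sup>+x. ennreal ((cmod (fourier f x))\<^sup>2) \<partial>lborel)"
  proof (rule nn_integral_LIMSEQ)
    have "gauss (r n *\<^sub>R x) \<le> gauss (r (Suc n) *\<^sub>R x)" for n and x :: "real^'d"
    proof -
      have "norm (r (Suc n) *\<^sub>R x) \<le> norm (r n *\<^sub>R x)"
        using r(1)[of n] r(1)[of "Suc n"] r(2)[of n] by (simp add: mult_right_mono)
      then show ?thesis
        by (simp add: gauss_def power_mono del: norm_scaleR)
    qed
    then show "incseq (\<lambda>n x. ennreal ((cmod (fourier f x))\<^sup>2 * gauss (r n *\<^sub>R x)))"
      by (intro incseq_SucI le_funI ennreal_leI mult_left_mono) auto
    fix x :: "real^'d"
    have "(\<lambda>n. (cmod (fourier f x))\<^sup>2 * gauss (r n *\<^sub>R x)) \<longlonglongrightarrow> (cmod (fourier f x))\<^sup>2 * gauss (0 *\<^sub>R x)"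
      unfolding gauss_def by (intro tendsto_intros r0)
    then show "(\<lambda>n. ennreal ((cmod (fourier f x))\<^sup>2 * gauss (r n *\<^sub>R x)))
        \<longlonglongrightarrow> ennreal ((cmod (fourier f x))\<^sup>2)"
      by (intro tendsto_ennrealI) (simp add: gauss_def)
  qed measurable
  ultimately show ?thesis
    by (simp only:) (rule LIMSEQ_unique)
qed

lemma square_integrable_fourier:
  assumes "integrable lborel f" "square_integrable f"
  shows "square_integrable (fourier f)"
  using Plancherel[OF assms] assms
  by (intro square_integrableI_nn borel_measurable_fourier) auto

section \<open>Passing isometries to the limit\<close>

text \<open>
  A form of the triangle inequality that is linear in the squares, so that it can be integrated
  as it stands; \<open>t\<close> near \<open>1\<close> loses little in the main term.
\<close>
lemma square_split_le:
  fixes a b :: real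
  assumes t: "0 < t" "t < 1"
  shows "t * (a + b)\<^sup>2 \<le> a\<^sup>2 + t / (1 - t) * b\<^sup>2"
proof -
  have "(a\<^sup>2 + t / (1 - t) * b\<^sup>2 - t * (a + b)\<^sup>2) * (1 - t) = ((1 - t) * a - t * b)\<^sup>2"
  proof -
    have "(a\<^sup>2 + t / (1 - t) * b\<^sup>2 - t * (a + b)\<^sup>2) * (1 - t)
        = a\<^sup>2 * (1 - t) + t * b\<^sup>2 - t * (a + b)\<^sup>2 * (1 - t)"
      using t by (simp add: left_diff_distrib distrib_right)
    then show ?thesis
      by (simp add: power2_eq_square algebra_simps)
  qed
  then have "0 \<le> (a\<^sup>2 + t / (1 - t) * b\<^sup>2 - t * (a + b)\<^sup>2) * (1 - t)"
    by simp
  then show ?thesis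
    using t by (simp add: zero_le_mult_iff)
qed

text \<open>
  If \<open>z\<^sub>n \<mapsto> u\<^sub>n\<close> preserves norms and distances, \<open>z\<^sub>n\<close> converges in norm and \<open>u\<^sub>n\<close> converges
  pointwise, then the limits have equal norms. Fatou's lemma gives one inequality. It also gives
  \<open>u\<^sub>n \<rightarrow> v\<close> in norm, because the \<open>u\<^sub>n\<close> form a Cauchy sequence, and this gives the other.
\<close>
lemma nn_integral_isometry_limit:
  fixes u :: "nat \<Rightarrow> 'a \<Rightarrow> complex" and z :: "nat \<Rightarrow> 'b::real_normed_vector"
  assumes meas [measurable]: "\<And>n. u n \<in> borel_measurable M" "v \<in> borel_measurable M"
    and lim: "AE x in M. (\<lambda>n. u n x) \<longlonglongrightarrow> v x"
    and norm: "\<And>n. (\<integral>\<^sup>+x. ennreal ((cmod (u n x))\<^sup>2) \<partial>M) = ennreal ((norm (z n))\<^sup>2)"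
    and dist: "\<And>n m. (\<integral>\<^sup>+x. ennreal ((cmod (u n x - u m x))\<^sup>2) \<partial>M) = ennreal ((dist (z n) (z m))\<^sup>2)"
    and z: "z \<longlonglongrightarrow> a"
  shows "(\<integral>\<^sup>+x. ennreal ((cmod (v x))\<^sup>2) \<partial>M) = ennreal ((norm a)\<^sup>2)"
proof -
  define V where "V = (\<integral>\<^sup>+x. ennreal ((cmod (v x))\<^sup>2) \<partial>M)"
  have nz: "(\<lambda>n. (norm (z n))\<^sup>2) \<longlonglongrightarrow> (norm a)\<^sup>2"
    by (intro tendsto_intros z)
  have V_le: "V \<le> ennreal ((norm a)\<^sup>2) + ennreal e" if "e > 0" for e
    unfolding V_def
  proof (rule nn_integral_square_Fatou[OF meas lim])
    have "\<forall>\<^sub>F n in sequentially. (norm (z n))\<^sup>2 < (norm a)\<^sup>2 + e"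
      using that by (intro order_tendstoD(2)[OF nz]) simp
    then show "\<forall>\<^sub>F n in sequentially. (\<integral>\<^sup>+x. ennreal ((cmod (u n x))\<^sup>2) \<partial>M)
        \<le> ennreal ((norm a)\<^sup>2) + ennreal e"
      by eventually_elim (use that in \<open>simp add: norm less_imp_le flip: ennreal_plus\<close>)
  qed
  have le: "V \<le> ennreal ((norm a)\<^sup>2)"
    by (rule ennreal_le_epsilon) (rule V_le)
  then obtain c where c: "V = ennreal c" "c \<ge> 0"
    by (cases V) (auto simp: top_unique)
  have "t * (norm a)\<^sup>2 \<le> c" if t: "0 < t" "t < 1" for t
  proof (rule field_le_epsilon)
    fix e :: real assume e: "e > 0"
    define C where "C = t / (1 - t)"
    have C: "C > 0" using t by (simp add: C_def)
    define d where "d = sqrt (e / (2 * C))"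
    have d: "d > 0" "C * d\<^sup>2 = e / 2"
      using e C by (simp_all add: d_def)
    have "Cauchy z"
      using z by (rule LIMSEQ_imp_Cauchy)
    then obtain N where N: "\<And>n m. n \<ge> N \<Longrightarrow> m \<ge> N \<Longrightarrow> dist (z n) (z m) < d"
      using d(1) unfolding Cauchy_def by metis
    have ev: "t * (norm (z n))\<^sup>2 \<le> c + e / 2" if n: "n \<ge> N" for n
    proof -
      have "(\<integral>\<^sup>+x. ennreal ((cmod (u n x - v x))\<^sup>2) \<partial>M) \<le> ennreal (d\<^sup>2)"
      proof (rule nn_integral_square_Fatou)
        show "AE x in M. (\<lambda>m. u n x - u m x) \<longlonglongrightarrow> u n x - v x"
          using lim by eventually_elim (intro tendsto_intros)
        show "\<forall>\<^sub>F m in sequentially. (\<integral>\<^sup>+x. ennreal ((cmod (u n x - u m x))\<^sup>2) \<partial>M) \<le> ennreal (d\<^sup>2)"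
          using N[OF n] unfolding eventually_sequentially dist
          by (intro exI[of _ N] allI impI ennreal_leI power_mono) (auto simp: less_imp_le)
      qed measurable
      then have "ennreal C * (\<integral>\<^sup>+x. ennreal ((cmod (u n x - v x))\<^sup>2) \<partial>M) \<le> ennreal (C * d\<^sup>2)"
        using C by (simp add: ennreal_mult mult_left_mono)
      then have small: "ennreal C * (\<integral>\<^sup>+x. ennreal ((cmod (u n x - v x))\<^sup>2) \<partial>M) \<le> ennreal (e / 2)"
        by (simp add: d)
      have pointwise: "t * (cmod (u n x))\<^sup>2 \<le> (cmod (v x))\<^sup>2 + C * (cmod (u n x - v x))\<^sup>2" for x
      proof -
        have "(cmod (u n x))\<^sup>2 \<le> (cmod (v x) + cmod (u n x - v x))\<^sup>2"
          by (intro power_mono norm_triangle_sub) auto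
        then have "t * (cmod (u n x))\<^sup>2 \<le> t * (cmod (v x) + cmod (u n x - v x))\<^sup>2"
          using t by simp
        then show ?thesis
          using square_split_le[OF t, of "cmod (v x)" "cmod (u n x - v x)"] by (simp add: C_def)
      qed
      have "ennreal (t * (norm (z n))\<^sup>2) = (\<integral>\<^sup>+x. ennreal (t * (cmod (u n x))\<^sup>2) \<partial>M)"
        using t norm[of n] by (simp add: ennreal_mult nn_integral_cmult)
      also have "\<dots> \<le> (\<integral>\<^sup>+x. ennreal ((cmod (v x))\<^sup>2) + ennreal C * ennreal ((cmod (u n x - v x))\<^sup>2) \<partial>M)"
        using C by (intro nn_integral_mono) (simp add: pointwise flip: ennreal_mult ennreal_plus)
      also have "\<dots> = V + ennreal C * (\<integral>\<^sup>+x. ennreal ((cmod (u n x - v x))\<^sup>2) \<partial>M)"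
        by (simp add: V_def nn_integral_add nn_integral_cmult)
      also have "\<dots> \<le> ennreal c + ennreal (e / 2)"
        unfolding c(1) by (intro add_left_mono small)
      also have "\<dots> = ennreal (c + e / 2)"
        using c e by simp
      finally show ?thesis
        using c e by (simp del: ennreal_plus)
    qed
    have "t * (norm a)\<^sup>2 \<le> c + e / 2"
      by (rule LIMSEQ_le_const2[OF tendsto_mult_left[OF nz]]) (use ev in blast)
    then show "t * (norm a)\<^sup>2 \<le> c + e"
      using e by simp
  qed
  then have "(norm a)\<^sup>2 \<le> c"
    by (rule field_le_mult_one_interval)
  then show ?thesis
    using le c by (simp add: V_def[symmetric])
qed

section \<open>The wavelet transform at a fixed scale\<close>

text \<open>
  A correlation is integrable and, by the Cauchy-Schwarz inequality, bounded.
\<close>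
lemma square_integrable_correlate:
  assumes f: "integrable lborel f" "square_integrable f" and g: "integrable lborel g" "square_integrable g"
  shows "square_integrable (correlate f g)"
  unfolding square_integrable_def
proof
  show "correlate f g \<in> borel_measurable lborel"
    using integrable_correlate[OF f(1) g(1)] by simp
  show "integrable lborel (\<lambda>t. (cmod (correlate f g t))\<^sup>2)"
  proof (rule Bochner_Integration.integrable_bound)
    show "integrable lborel (\<lambda>t. (norm (to_L2 f) * norm (to_L2 g)) * cmod (correlate f g t))"
      using integrable_correlate[OF f(1) g(1)] by simp
    show "AE t in lborel. norm ((cmod (correlate f g t))\<^sup>2)
        \<le> norm ((norm (to_L2 f) * norm (to_L2 g)) * cmod (correlate f g t))"
      by (simp add: power2_eq_square mult_right_mono norm_correlate_le f g)
  qed (use integrable_correlate[OF f(1) g(1)] in simp)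
qed

lemma nn_integral_correlate:
  assumes f: "integrable lborel f" "square_integrable f" and g: "integrable lborel g" "square_integrable g"
  shows "(\<integral>\<^sup>+x. ennreal ((cmod (correlate f g x))\<^sup>2) \<partial>lborel)
    = (\<integral>\<^sup>+\<omega>. ennreal ((cmod (fourier f \<omega> * cnj (fourier g \<omega>)))\<^sup>2) \<partial>lborel)"
  using Plancherel[OF integrable_correlate[OF f(1) g(1)] square_integrable_correlate[OF f g]]
    nn_integral_norm_to_L2[OF square_integrable_correlate[OF f g]]
  by (simp only: fourier_correlate[OF f(1) g(1)])

lemma wavelet_transform_to_L2:
  assumes "square_integrable f" "square_integrable g" "s > 0"
  shows "wavelet_transform (to_L2 g) (to_L2 f) x s = correlate f (wavelet_atom_fun g 0 s) x"
  using wavelet_atom_to_L2[of g s x] assms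
  by (simp add: wavelet_transform_def cinner_to_L2 square_integrable_wavelet_atom_fun correlate_def)
    (simp add: wavelet_atom_fun_def)

lemma integrable_wavelet_atom_fun:
  assumes "integrable lborel g" "s > 0"
  shows "integrable lborel (wavelet_atom_fun g x s)"
  using integrable_lborel_affine[OF assms(1), of "inverse s" "- (inverse s *\<^sub>R x)"] assms
  unfolding wavelet_atom_fun_def by (intro integrable_mult_right) (simp add: algebra_simps)

lemma fourier_wavelet_atom_fun:
  fixes g :: "real^'d::finite \<Rightarrow> complex"
  assumes [measurable]: "g \<in> borel_measurable borel" and s: "s > 0"
  shows "fourier (wavelet_atom_fun g 0 s) \<omega> = of_real (s powr (real CARD('d) / 2)) * fourier g (s *\<^sub>R \<omega>)"
proof -
  have "s powr (- (real CARD('d) / 2)) * s ^ CARD('d) = s powr (real CARD('d) / 2)"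
    using s by (simp flip: powr_realpow powr_add)
  then have eq: "complex_of_real (s powr (- (real CARD('d) / 2))) * of_real (s ^ CARD('d))
      = of_real (s powr (real CARD('d) / 2))"
    by (metis of_real_mult)
  have "fourier (wavelet_atom_fun g 0 s) \<omega>
      = complex_of_real (s powr (- (real CARD('d) / 2))) * fourier (\<lambda>t. g (inverse s *\<^sub>R t)) \<omega>"
    by (simp add: fourier_eq wavelet_atom_fun_def mult.assoc)
  then show ?thesis
    by (simp only: fourier_dilate[OF assms] mult.assoc[symmetric] eq)
qed

text \<open>
  The Fourier transform of \<open>x \<mapsto> W\<^sub>g f (x, s)\<close>, written in terms of a Fourier transform \<open>G\<close> of \<open>g\<close>.
  In this form it makes sense for every square-integrable \<open>G\<close>.
\<close>
definition fourier_atom_product :: "(real^'d::finite \<Rightarrow> complex) \<Rightarrow> real \<Rightarrow> (real^'d \<Rightarrow> complex) \<Rightarrow> real^'d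
    \<Rightarrow> complex" where
  "fourier_atom_product f s G \<omega> = fourier f \<omega> * cnj (of_real (s powr (real CARD('d) / 2)) * G (s *\<^sub>R \<omega>))"

lemma norm_fourier_atom_product:
  fixes f :: "real^'d::finite \<Rightarrow> complex"
  assumes "s > 0"
  shows "(cmod (fourier_atom_product f s G \<omega>))\<^sup>2
      = (cmod (fourier f \<omega>))\<^sup>2 * (s ^ CARD('d) * (cmod (G (s *\<^sub>R \<omega>)))\<^sup>2)"
proof -
  have "(s powr (real CARD('d) / 2))\<^sup>2 = s ^ CARD('d)"
    using assms by (simp add: power2_eq_square powr_realpow flip: powr_add)
  then show ?thesis
    by (simp add: fourier_atom_product_def norm_mult power_mult_distrib)
qed

text \<open>
  The Fourier transform of an integrable function is bounded by the integral of its modulus, so the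
  product depends continuously on \<open>G\<close> in the norm of \<open>L\<^sup>2\<close>.
\<close>
lemma square_integrable_fourier_atom_product:
  fixes f G :: "real^'d::finite \<Rightarrow> complex"
  assumes f: "integrable lborel f" and G: "square_integrable G" and s: "s > 0"
  shows "square_integrable (fourier_atom_product f s G)"
    and "norm (to_L2 (fourier_atom_product f s G)) \<le> (\<integral>t. cmod (f t) \<partial>lborel) * norm (to_L2 G)"
proof -
  have [measurable]: "f \<in> borel_measurable borel" "G \<in> borel_measurable borel"
    using f G by auto
  have [measurable]: "fourier f \<in> borel_measurable borel"
    by (intro borel_measurable_fourier) simp
  define C where "C = (\<integral>t. cmod (f t) \<partial>lborel)"
  have C: "C \<ge> 0" by (simp add: C_def)
  have m [measurable]: "fourier_atom_product f s G \<in> borel_measurable borel"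
    unfolding fourier_atom_product_def by measurable
  have "(\<integral>\<^sup>+\<omega>. ennreal ((cmod (fourier_atom_product f s G \<omega>))\<^sup>2) \<partial>lborel)
      \<le> (\<integral>\<^sup>+\<omega>. ennreal (C\<^sup>2) * (ennreal (s ^ CARD('d)) * ennreal ((cmod (G (s *\<^sub>R \<omega>)))\<^sup>2)) \<partial>lborel)"
  proof (rule nn_integral_mono)
    fix \<omega>
    have "(cmod (fourier f \<omega>))\<^sup>2 \<le> C\<^sup>2"
      unfolding C_def by (intro power_mono norm_fourier_le f) auto
    then show "ennreal ((cmod (fourier_atom_product f s G \<omega>))\<^sup>2)
        \<le> ennreal (C\<^sup>2) * (ennreal (s ^ CARD('d)) * ennreal ((cmod (G (s *\<^sub>R \<omega>)))\<^sup>2))"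
      unfolding norm_fourier_atom_product[OF s] using s
      by (simp add: mult_right_mono flip: ennreal_mult)
  qed
  also have "\<dots> = ennreal (C\<^sup>2) * (ennreal (s ^ CARD('d))
      * (\<integral>\<^sup>+\<omega>. ennreal ((cmod (G (s *\<^sub>R \<omega>)))\<^sup>2) \<partial>lborel))"
    by (simp add: nn_integral_cmult)
  also have "ennreal (s ^ CARD('d)) * (\<integral>\<^sup>+\<omega>. ennreal ((cmod (G (s *\<^sub>R \<omega>)))\<^sup>2) \<partial>lborel)
      = ennreal ((norm (to_L2 G))\<^sup>2)"
    using nn_integral_lborel_affine[of "\<lambda>\<omega>. ennreal ((cmod (G \<omega>))\<^sup>2)" s 0] s
    by (simp add: nn_integral_norm_to_L2[OF G])
  finally have le: "(\<integral>\<^sup>+\<omega>. ennreal ((cmod (fourier_atom_product f s G \<omega>))\<^sup>2) \<partial>lborel)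
      \<le> ennreal ((C * norm (to_L2 G))\<^sup>2)"
    by (simp add: power_mult_distrib ennreal_mult)
  show sq: "square_integrable (fourier_atom_product f s G)"
    by (rule square_integrableI_nn[OF m]) (rule le_less_trans[OF le], simp)
  show "norm (to_L2 (fourier_atom_product f s G)) \<le> (\<integral>t. cmod (f t) \<partial>lborel) * norm (to_L2 G)"
    using le C unfolding nn_integral_norm_to_L2[OF sq] C_def[symmetric]
    by (auto intro: power2_le_imp_le)
qed

lemma dist_fourier_atom_product:
  assumes f: "integrable lborel f" and "square_integrable G" "square_integrable H" and s: "s > 0"
  shows "dist (to_L2 (fourier_atom_product f s G)) (to_L2 (fourier_atom_product f s H))
    = norm (to_L2 (fourier_atom_product f s (\<lambda>\<omega>. G \<omega> - H \<omega>)))"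
  using assms
  by (simp add: dist_norm diff_to_L2 square_integrable_fourier_atom_product)
    (simp add: fourier_atom_product_def[abs_def] ring_distribs)

lemma nn_integral_wavelet_transform_scale_integrable:
  fixes f g :: "real^'d::finite \<Rightarrow> complex"
  assumes f: "integrable lborel f" "square_integrable f" and g: "integrable lborel g" "square_integrable g"
    and s: "s > 0"
  shows "(\<integral>\<^sup>+x. ennreal ((cmod (wavelet_transform (to_L2 g) (to_L2 f) x s))\<^sup>2) \<partial>lborel)
    = ennreal ((norm (to_L2 (fourier_atom_product f s (fourier g))))\<^sup>2)"
proof -
  have [measurable]: "g \<in> borel_measurable borel" using g by auto
  have "(\<integral>\<^sup>+x. ennreal ((cmod (wavelet_transform (to_L2 g) (to_L2 f) x s))\<^sup>2) \<partial>lborel)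
      = (\<integral>\<^sup>+\<omega>. ennreal ((cmod (fourier f \<omega> * cnj (fourier (wavelet_atom_fun g 0 s) \<omega>)))\<^sup>2) \<partial>lborel)"
    using f g s
    by (simp add: wavelet_transform_to_L2 nn_integral_correlate integrable_wavelet_atom_fun
        square_integrable_wavelet_atom_fun)
  also have "\<dots> = (\<integral>\<^sup>+\<omega>. ennreal ((cmod (fourier_atom_product f s (fourier g) \<omega>))\<^sup>2) \<partial>lborel)"
    using s by (simp only: fourier_wavelet_atom_fun[OF _ s] fourier_atom_product_def \<open>g
        \<in> borel_measurable borel\<close>)
  also have "\<dots> = ennreal ((norm (to_L2 (fourier_atom_product f s (fourier g))))\<^sup>2)"
    by (intro nn_integral_norm_to_L2 square_integrable_fourier_atom_product square_integrable_fourier f g s)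
  finally show ?thesis .
qed

lemma continuous_on_wavelet_transform:
  "continuous_on (UNIV \<times> {0<..}) (\<lambda>p. wavelet_transform g f (fst p) (snd p))"
  using continuous_on_wavelet_atom[of g]
  unfolding continuous_on_def wavelet_transform_def
  by (auto intro!: tendsto_cinner_L2)

lemma wavelet_transform_diff_left:
  "wavelet_transform g (f - h) x s = wavelet_transform g f x s - wavelet_transform g h x s"
  by (simp add: wavelet_transform_def cinner_L2_diff_left)

lemma wavelet_transform_diff_right:
  "s > 0 \<Longrightarrow> wavelet_transform (g - h) f x s = wavelet_transform g f x s - wavelet_transform h f x s"
  using wavelet_atom_diff[of s, where g=g and h=h and x=x]
  by (simp add: wavelet_transform_def cinner_L2_diff_right)

text \<open>
  With this value the transform is measurable on the whole product space, although it is continuous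
  only on the half-space.
\<close>
lemma wavelet_transform_nonpos:
  "s \<le> 0 \<Longrightarrow> wavelet_transform g f x s = 0"
proof -
  assume s: "s \<le> 0"
  have "norm (wavelet_transform g f x s) \<le> norm f * norm (translate_L2 x (dilate_L2 s g))"
    unfolding wavelet_transform_def by (rule norm_cinner_L2_le)
  moreover have "dilate_L2 s g = 0"
    using s by (cases g rule: L2_cases) (simp add: dilate_L2.abs_eq zero_L2_def L2_rel_self_iff)
  ultimately show ?thesis
    by (simp add: norm_translate_L2)
qed

lemma borel_measurable_wavelet_transform [measurable]:
  "(\<lambda>p. wavelet_transform g f (fst p) (snd p)) \<in> borel_measurable borel"
proof -
  have "(\<lambda>p. indicator (UNIV \<times> {0<..}) p *\<^sub>R wavelet_transform g f (fst p) (snd p))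
      \<in> borel_measurable borel"
    by (intro borel_measurable_continuous_on_indicator continuous_on_wavelet_transform borel_open
        open_Times) auto
  also have "(\<lambda>p. indicator (UNIV \<times> {0<..}) p *\<^sub>R wavelet_transform g f (fst p) (snd p))
      = (\<lambda>p. wavelet_transform g f (fst p) (snd p))"
    by (auto simp: indicator_def wavelet_transform_nonpos fun_eq_iff)
  finally show ?thesis .
qed

lemma borel_measurable_wavelet_transform_scale [measurable]:
  "(\<lambda>x. wavelet_transform g f x s) \<in> borel_measurable borel"
  using measurable_compose[OF _ borel_measurable_wavelet_transform[of g f], of "\<lambda>x. (x, s)" borel]
  by (simp add: borel_prod[symmetric])

text \<open>
  Integrable wavelets are treated by Plancherel's theorem for a correlation. A wavelet in \<open>L\<^sup>2\<close> is
  by definition of its Fourier transform a limit of such wavelets whose transforms also converge;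
  for integrable \<open>f\<close> both sides follow this limit.
\<close>
theorem nn_integral_wavelet_transform_scale:
  fixes f :: "real^'d::finite \<Rightarrow> complex"
  assumes f: "integrable lborel f" "square_integrable f"
    and G: "square_integrable G" "has_fourier_L2 g (to_L2 G)" and s: "s > 0"
  shows "(\<integral>\<^sup>+x. ennreal ((cmod (wavelet_transform g (to_L2 f) x s))\<^sup>2) \<partial>lborel)
    = (\<integral>\<^sup>+\<omega>. ennreal ((cmod (fourier f \<omega>))\<^sup>2 * (s ^ CARD('d) * (cmod (G (s *\<^sub>R \<omega>)))\<^sup>2)) \<partial>lborel)"
proof -
  obtain q where q: "\<And>n. q n \<in> {(to_L2 h, to_L2 (fourier h)) | h. integrable lborel h \<and>
      square_integrable h \<and> square_integrable (fourier h)}"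
    and qlim: "q \<longlonglongrightarrow> (g, to_L2 G)"
    using G(2) unfolding has_fourier_L2_def closure_sequential by blast
  have "\<forall>n. \<exists>h. q n = (to_L2 h, to_L2 (fourier h)) \<and> integrable lborel h \<and> square_integrable h"
    using q by blast
  then obtain h where h: "\<And>n. q n = (to_L2 (h n), to_L2 (fourier (h n)))" "\<And>n. integrable lborel (h n)"
    "\<And>n. square_integrable (h n)"
    by (auto dest!: choice)
  have hg: "(\<lambda>n. to_L2 (h n)) \<longlonglongrightarrow> g" and hG: "(\<lambda>n. to_L2 (fourier (h n))) \<longlonglongrightarrow> to_L2 G"
    using tendsto_fst[OF qlim] tendsto_snd[OF qlim] by (simp_all add: h(1))
  note sqh = square_integrable_fourier[OF h(2,3)]
  have "(\<integral>\<^sup>+x. ennreal ((cmod (wavelet_transform g (to_L2 f) x s))\<^sup>2) \<partial>lborel)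
      = ennreal ((norm (to_L2 (fourier_atom_product f s G)))\<^sup>2)"
  proof (rule nn_integral_isometry_limit)
    show "(\<lambda>x. wavelet_transform (to_L2 (h n)) (to_L2 f) x s) \<in> borel_measurable lborel" for n
      by simp
    show "(\<lambda>x. wavelet_transform g (to_L2 f) x s) \<in> borel_measurable lborel"
      by simp
    show "AE x in lborel. (\<lambda>n. wavelet_transform (to_L2 (h n)) (to_L2 f) x s)
        \<longlonglongrightarrow> wavelet_transform g (to_L2 f) x s"
    proof
      fix x
      have "(\<lambda>n. wavelet_atom (to_L2 (h n)) (x, s)) \<longlonglongrightarrow> wavelet_atom g (x, s)"
        using hg by (subst tendsto_dist_iff) (simp only: dist_wavelet_atom[OF s] flip: tendsto_dist_iff)
      then show "(\<lambda>n. wavelet_transform (to_L2 (h n)) (to_L2 f) x s) \<longlonglongrightarrow> wavelet_transform g (to_L2 f) x s"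
        unfolding wavelet_transform_def by (intro tendsto_cinner_L2 tendsto_const) simp
    qed
    show "(\<integral>\<^sup>+x. ennreal ((cmod (wavelet_transform (to_L2 (h n)) (to_L2 f) x s))\<^sup>2) \<partial>lborel)
        = ennreal ((norm (to_L2 (fourier_atom_product f s (fourier (h n)))))\<^sup>2)" for n
      by (rule nn_integral_wavelet_transform_scale_integrable[OF f h(2,3) s])
    show "(\<integral>\<^sup>+x. ennreal ((cmod (wavelet_transform (to_L2 (h n)) (to_L2 f) x s
          - wavelet_transform (to_L2 (h m)) (to_L2 f) x s))\<^sup>2) \<partial>lborel)
        = ennreal ((dist (to_L2 (fourier_atom_product f s (fourier (h n))))
          (to_L2 (fourier_atom_product f s (fourier (h m)))))\<^sup>2)" for n m
    proof -
      have "fourier (\<lambda>t. h n t - h m t) = (\<lambda>\<omega>. fourier (h n) \<omega> - fourier (h m) \<omega>)"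
        by (intro ext fourier_diff h)
      then show ?thesis
        using nn_integral_wavelet_transform_scale_integrable[OF f _ _ s, of
            "\<lambda>t. h n t - h m t"] h(2,3)[of n] h(2,3)[of m]
        by (simp add: dist_fourier_atom_product f sqh s square_integrable_diff
            wavelet_transform_diff_right[OF s] flip: diff_to_L2)
    qed
    show "(\<lambda>n. to_L2 (fourier_atom_product f s (fourier (h n)))) \<longlonglongrightarrow> to_L2 (fourier_atom_product f s G)"
    proof (subst tendsto_dist_iff, rule Lim_null_comparison)
      show "\<forall>\<^sub>F n in sequentially. norm (dist (to_L2 (fourier_atom_product f s (fourier (h n))))
          (to_L2 (fourier_atom_product f s G)))
          \<le> (\<integral>t. cmod (f t) \<partial>lborel) * dist (to_L2 (fourier (h n))) (to_L2 G)"
        using square_integrable_fourier_atom_product(2)[OF f(1) square_integrable_diff[OF sqh G(1)] s]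
        by (simp add: dist_fourier_atom_product f sqh s G(1)) (simp add: dist_norm diff_to_L2 sqh G(1))
      show "(\<lambda>n. (\<integral>t. cmod (f t) \<partial>lborel) * dist (to_L2 (fourier (h n))) (to_L2 G)) \<longlonglongrightarrow> 0"
        using hG by (intro tendsto_mult_right_zero) (simp flip: tendsto_dist_iff)
    qed
  qed
  also have "\<dots> = (\<integral>\<^sup>+\<omega>. ennreal ((cmod (fourier_atom_product f s G \<omega>))\<^sup>2) \<partial>lborel)"
    by (intro nn_integral_norm_to_L2[symmetric] square_integrable_fourier_atom_product f G s)
  finally show ?thesis
    by (simp only: norm_fourier_atom_product[OF s])
qed

section \<open>The wavelet isometry\<close>

text \<open>
  The measure \<open>dx ds / s\<^bsup>d+1\<^esup>\<close>, a left Haar measure on the group of translations and dilations,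
  extended by \<open>0\<close> to nonpositive scales.
\<close>
definition haar_measure :: "((real^'d::finite) \<times> real) measure" where
  "haar_measure = density lborel (\<lambda>p. ennreal (1 / snd p ^ (CARD('d) + 1)) * indicator (UNIV \<times> {0<..}) p)"

lemma sets_haar_measure [measurable_cong, simp]: "sets haar_measure = sets borel"
  by (simp add: haar_measure_def)

lemma half_space_measurable [measurable]:
  "(UNIV \<times> {0<..} :: ((real^'d::finite) \<times> real) set) \<in> sets borel"
  "indicator (UNIV \<times> {0<..}) \<in> borel_measurable (borel :: ((real^'d) \<times> real) measure)"
  "snd \<in> borel_measurable (borel :: ((real^'d) \<times> real) measure)"
proof -
  show *: "(UNIV \<times> {0<..} :: ((real^'d) \<times> real) set) \<in> sets borel"
    by (intro borel_open open_Times) auto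
  show "indicator (UNIV \<times> {0<..}) \<in> borel_measurable (borel :: ((real^'d) \<times> real) measure)"
    by (intro borel_measurable_indicator *)
  show "snd \<in> borel_measurable (borel :: ((real^'d) \<times> real) measure)"
    by (intro borel_measurable_continuous_onI continuous_intros)
qed

lemma haar_density_measurable [measurable]:
  fixes u :: "(real^'d::finite) \<times> real \<Rightarrow> real"
  assumes [measurable]: "u \<in> borel_measurable borel"
  shows "(\<lambda>p. ennreal (u p / snd p ^ n) * indicator (UNIV \<times> {0<..}) p) \<in> borel_measurable borel"
  by (intro borel_measurable_times borel_measurable_times_ennreal measurable_compose[OF _
      measurable_ennreal]
      borel_measurable_divide borel_measurable_power assms half_space_measurable)

lemma nn_integral_haar:
  fixes u :: "(real^'d::finite) \<times> real \<Rightarrow> real"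
  assumes "A \<in> sets borel" "u \<in> borel_measurable borel" "\<And>p. u p \<ge> 0"
  shows "(\<integral>\<^sup>+p. ennreal (u p) * indicator A p \<partial>haar_measure)
    = (\<integral>\<^sup>+p. ennreal (u p / snd p ^ (CARD('d) + 1)) * indicator (UNIV \<times> {0<..} \<inter> A) p \<partial>lborel)"
proof -
  have [measurable]: "A \<in> sets borel" "u \<in> borel_measurable borel" by fact+
  have "(\<integral>\<^sup>+p. ennreal (u p) * indicator A p \<partial>haar_measure)
      = (\<integral>\<^sup>+p. (ennreal (1 / snd p ^ (CARD('d)
          + 1)) * indicator (UNIV \<times> {0<..}) p) * (ennreal (u p) * indicator A p) \<partial>lborel)"
    unfolding haar_measure_def using haar_density_measurable[of "\<lambda>_. 1" "CARD('d) + 1"]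
    by (intro nn_integral_density) auto
  also have "\<dots> = (\<integral>\<^sup>+p. ennreal (u p / snd p ^ (CARD('d) + 1)) * indicator (UNIV \<times> {0<..} \<inter> A) p \<partial>lborel)"
  proof (rule nn_integral_cong)
    fix p :: "(real^'d) \<times> real"
    show "(ennreal (1 / snd p ^ (CARD('d) + 1)) * indicator (UNIV \<times> {0<..}) p) * (ennreal (u p)
        * indicator A p)
        = ennreal (u p / snd p ^ (CARD('d) + 1)) * indicator (UNIV \<times> {0<..} \<inter> A) p"
      using assms(3)[of p] by (auto simp: indicator_def simp flip: ennreal_mult)
  qed
  finally show ?thesis .
qed

text \<open>
  After Plancherel's theorem at each scale, the factor \<open>s\<^sup>d\<close> leaves \<open>ds / s\<close> of the measure
  \<open>ds / s\<^bsup>d+1\<^esup>\<close>. By Tonelli's theorem the integral over \<open>s\<close> may come first. For \<open>\<omega> \<noteq> 0\<close>, hence almost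
  everywhere, it is the admissibility integral.
\<close>
lemma wavelet_isometry_integrable:
  fixes f :: "real^'d::finite \<Rightarrow> complex"
  assumes adm: "admissible g" and f: "integrable lborel f" "square_integrable f"
  shows "(\<integral>\<^sup>+p. ennreal ((cmod (wavelet_transform g (to_L2 f) (fst p) (snd p)))\<^sup>2) \<partial>haar_measure)
    = ennreal ((norm (to_L2 f))\<^sup>2)"
proof -
  obtain G where G: "square_integrable G" "has_fourier_L2 g (to_L2 G)"
    "\<And>\<omega>. \<omega> \<noteq> 0 \<Longrightarrow> (\<integral>\<^sup>+ t \<in> {0<..}. ennreal ((cmod (G (t *\<^sub>R \<omega>)))\<^sup>2 / t) \<partial>lborel) = 1"
    using adm by (auto simp: admissible_def)
  have [measurable]: "f \<in> borel_measurable borel" "G \<in> borel_measurable borel" "fourier f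
      \<in> borel_measurable borel"
    using f G borel_measurable_fourier by auto
  let ?W = "\<lambda>x s. (cmod (wavelet_transform g (to_L2 f) x s))\<^sup>2"
  have "(\<integral>\<^sup>+p. ennreal (?W (fst p) (snd p)) \<partial>haar_measure)
      = (\<integral>\<^sup>+p. ennreal (?W (fst p) (snd p) / snd p ^ (CARD('d)
          + 1)) * indicator (UNIV \<times> {0<..}) p \<partial>(lborel \<Otimes>\<^sub>M lborel))"
    using nn_integral_haar[of UNIV "\<lambda>p. ?W (fst p) (snd p)"] by (simp add: lborel_prod)
  also have "\<dots> = (\<integral>\<^sup>+s. \<integral>\<^sup>+x. ennreal (?W x s / s ^ (CARD('d) + 1)) * indicator {0<..} s \<partial>lborel \<partial>lborel)"
  proof -
    have "(\<lambda>p. ennreal (?W (fst p) (snd p) / snd p ^ (CARD('d) + 1)) * indicator (UNIV \<times> {0<..}) p)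
        \<in> borel_measurable (lborel \<Otimes>\<^sub>M lborel)"
      unfolding lborel_prod measurable_lborel2 by (intro haar_density_measurable) measurable
    from lborel_pair.nn_integral_snd[OF this] show ?thesis
      by (simp add: indicator_def)
  qed
  also have "\<dots> = (\<integral>\<^sup>+s. \<integral>\<^sup>+\<omega>. ennreal ((cmod (fourier f \<omega>))\<^sup>2) * (ennreal ((cmod (G (s *\<^sub>R \<omega>)))\<^sup>2 / s)
      * indicator {0<..} s) \<partial>lborel \<partial>lborel)"
  proof (rule nn_integral_cong)
    fix s :: real
    show "(\<integral>\<^sup>+x. ennreal (?W x s / s ^ (CARD('d) + 1)) * indicator {0<..} s \<partial>lborel)
        = (\<integral>\<^sup>+\<omega>. ennreal ((cmod (fourier f \<omega>))\<^sup>2) * (ennreal ((cmod (G (s *\<^sub>R \<omega>)))\<^sup>2 / s)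
            * indicator {0<..} s) \<partial>lborel)"
    proof (cases "s > 0")
      case True
      have "(\<integral>\<^sup>+x. ennreal (?W x s / s ^ (CARD('d) + 1)) * indicator {0<..} s \<partial>lborel)
          = ennreal (1 / s ^ (CARD('d) + 1)) * (\<integral>\<^sup>+x. ennreal (?W x s) \<partial>lborel)"
        using True by (subst nn_integral_cmult[symmetric]) (auto simp flip: ennreal_mult)
      also have "\<dots> = (\<integral>\<^sup>+\<omega>. ennreal (1 / s ^ (CARD('d) + 1)) *
          ennreal ((cmod (fourier f \<omega>))\<^sup>2 * (s ^ CARD('d) * (cmod (G (s *\<^sub>R \<omega>)))\<^sup>2)) \<partial>lborel)"
        unfolding nn_integral_wavelet_transform_scale[OF f G(1,2) True]
        by (rule nn_integral_cmult[symmetric]) measurable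
      also have "\<dots> = (\<integral>\<^sup>+\<omega>. ennreal ((cmod (fourier f \<omega>))\<^sup>2) * (ennreal ((cmod (G (s *\<^sub>R \<omega>)))\<^sup>2 / s)
          * indicator {0<..} s) \<partial>lborel)"
        using True by (intro nn_integral_cong) (simp flip: ennreal_mult)
      finally show ?thesis .
    qed simp
  qed
  also have "\<dots> = (\<integral>\<^sup>+\<omega>. \<integral>\<^sup>+s. ennreal ((cmod (fourier f \<omega>))\<^sup>2) * (ennreal ((cmod (G (s *\<^sub>R \<omega>)))\<^sup>2 / s)
      * indicator {0<..} s) \<partial>lborel \<partial>lborel)"
    by (rule lborel_pair.Fubini') measurable
  also have "\<dots> = (\<integral>\<^sup>+\<omega>. ennreal ((cmod (fourier f \<omega>))\<^sup>2) \<partial>lborel)"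
  proof (rule nn_integral_cong_AE)
    show "AE \<omega> in lborel. (\<integral>\<^sup>+s. ennreal ((cmod (fourier f \<omega>))\<^sup>2)
        * (ennreal ((cmod (G (s *\<^sub>R \<omega>)))\<^sup>2 / s) * indicator {0<..} s) \<partial>lborel)
        = ennreal ((cmod (fourier f \<omega>))\<^sup>2)"
      using AE_lborel_singleton[of 0]
      by eventually_elim (simp add: nn_integral_cmult G(3))
  qed
  also have "\<dots> = ennreal ((norm (to_L2 f))\<^sup>2)"
    by (rule Plancherel[OF f])
  finally show ?thesis .
qed

lemma continuous_bounded_support_integrable:
  assumes "f \<in> continuous_bounded_support"
  shows "integrable lborel f"
proof -
  obtain M R where M: "M \<ge> 0" "\<And>t. cmod (f t) \<le> M * indicator (cball 0 R) t"
    using continuous_bounded_support_bound[OF assms] by blast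
  show ?thesis
  proof (rule Bochner_Integration.integrable_bound)
    show "integrable lborel (\<lambda>t. M * indicator (cball 0 R) t)"
      by (intro integrable_mult_right integrable_real_indicator)
        (use emeasure_lborel_cball_finite[of 0 R] in auto)
    show "AE t in lborel. norm (f t) \<le> norm (M * indicator (cball 0 R) t)"
      using M by (intro AE_I2) (simp add: abs_mult)
  qed (use continuous_bounded_support_measurable[OF assms] in simp)
qed

text \<open>
  Continuous functions of bounded support are integrable and dense, and the transform at each point
  is continuous in the signal, so the limit principle applies.
\<close>
theorem wavelet_isometry:
  fixes f g :: "'d::finite L2"
  assumes adm: "admissible g"
  shows "(\<integral>\<^sup>+p. ennreal ((cmod (wavelet_transform g f (fst p) (snd p)))\<^sup>2) \<partial>haar_measure)
      = ennreal ((norm f)\<^sup>2)"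
proof -
  have "f \<in> closure (to_L2 ` continuous_bounded_support)"
    by (simp add: continuous_bounded_support_dense_L2)
  then obtain z where z: "\<And>n. z n \<in> to_L2 ` continuous_bounded_support" "z \<longlonglongrightarrow> f"
    unfolding closure_sequential by blast
  then have "\<forall>n. \<exists>h. h \<in> continuous_bounded_support \<and> z n = to_L2 h"
    by blast
  then obtain h where h: "\<And>n. h n \<in> continuous_bounded_support" "\<And>n. z n = to_L2 (h n)"
    by (auto dest!: choice)
  note int = continuous_bounded_support_integrable[OF h(1)]
    and sq = continuous_bounded_support_square_integrable[OF h(1)]
  show ?thesis
  proof (rule nn_integral_isometry_limit[OF _ _ _ _ _ z(2)])
    show "AE p in haar_measure. (\<lambda>n. wavelet_transform g (z n) (fst p) (snd p))
        \<longlonglongrightarrow> wavelet_transform g f (fst p) (snd p)"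
      unfolding wavelet_transform_def by (intro AE_I2 tendsto_cinner_L2 z(2) tendsto_const)
    show "(\<integral>\<^sup>+p. ennreal ((cmod (wavelet_transform g (z n) (fst p) (snd p)))\<^sup>2) \<partial>haar_measure)
        = ennreal ((norm (z n))\<^sup>2)" for n
      unfolding h(2) by (rule wavelet_isometry_integrable[OF adm int sq])
    show "(\<integral>\<^sup>+p. ennreal ((cmod (wavelet_transform g (z n) (fst p) (snd p) - wavelet_transform g (z m)
        (fst p) (snd p)))\<^sup>2) \<partial>haar_measure)
        = ennreal ((dist (z n) (z m))\<^sup>2)" for n m
      unfolding wavelet_transform_diff_left[symmetric] h(2) dist_norm diff_to_L2[OF sq sq]
      by (intro wavelet_isometry_integrable[OF adm] Bochner_Integration.integrable_diff int
          square_integrable_diff sq)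
  qed measurable
qed

section \<open>Wavelet energy in subsets of the half-space\<close>

definition wavelet_energy :: "'d::finite L2 \<Rightarrow> 'd L2 \<Rightarrow> ((real^'d) \<times> real) set \<Rightarrow> ennreal" where
  "wavelet_energy g f A
    = (\<integral>\<^sup>+p. ennreal ((cmod (wavelet_transform g f (fst p) (snd p)))\<^sup>2) * indicator A p \<partial>haar_measure)"

lemma wavelet_energy_Compl_eq:
  fixes g f :: "'d::finite L2"
  assumes "compact U"
  shows "(\<integral>\<^sup>+ (x, s) \<in> (UNIV \<times> {0<..}) - U.
      ennreal ((cmod (wavelet_transform g f x s))\<^sup>2 / s ^ (CARD('d) + 1)) \<partial>lborel)
          = wavelet_energy g f (- U)"
proof -
  have "- U \<in> sets borel"
    using assms by (intro borel_comp borel_closed compact_imp_closed)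
  then show ?thesis
    unfolding wavelet_energy_def
    by (subst nn_integral_haar) (auto simp: case_prod_unfold Diff_eq)
qed

text \<open>
  The factor \<open>2\<close> is the price for an inequality between the energies instead of their square roots.
\<close>
lemma wavelet_energy_le_diff:
  assumes [measurable]: "A \<in> sets borel"
  shows "wavelet_energy g f A \<le> 2 * wavelet_energy g h A + 2 * wavelet_energy g (f - h) A"
proof -
  let ?W = "\<lambda>f p. wavelet_transform g f (fst p) (snd p)"
  have "wavelet_energy g f A \<le> (\<integral>\<^sup>+p. 2 * (ennreal ((cmod (?W h p))\<^sup>2) * indicator A p)
      + 2 * (ennreal ((cmod (?W (f - h) p))\<^sup>2) * indicator A p) \<partial>haar_measure)"
    unfolding wavelet_energy_def
  proof (rule nn_integral_mono)
    fix p
    have "cmod (?W f p) \<le> cmod (?W h p) + cmod (?W (f - h) p)"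
      by (simp add: wavelet_transform_diff_left norm_triangle_sub)
    then have "(cmod (?W f p))\<^sup>2 \<le> (cmod (?W h p) + cmod (?W (f - h) p))\<^sup>2"
      by (intro power_mono) auto
    also have "\<dots> \<le> 2 * (cmod (?W h p))\<^sup>2 + 2 * (cmod (?W (f - h) p))\<^sup>2"
      using sum_squares_bound[of "cmod (?W h p)" "cmod (?W (f - h) p)"] by (simp add: power2_sum)
    finally have "ennreal ((cmod (?W f p))\<^sup>2)
        \<le> ennreal (2 * (cmod (?W h p))\<^sup>2 + 2 * (cmod (?W (f - h) p))\<^sup>2)"
      by (rule ennreal_leI)
    then show "ennreal ((cmod (?W f p))\<^sup>2) * indicator A p
        \<le> 2 * (ennreal ((cmod (?W h p))\<^sup>2) * indicator A p)
      + 2 * (ennreal ((cmod (?W (f - h) p))\<^sup>2) * indicator A p)"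
      by (cases "p \<in> A") (simp_all add: ennreal_mult)
  qed
  also have "\<dots> = 2 * wavelet_energy g h A + 2 * wavelet_energy g (f - h) A"
    unfolding wavelet_energy_def by (simp add: nn_integral_add nn_integral_cmult)
  finally show ?thesis .
qed

lemma wavelet_energy_minus: "wavelet_energy g (- f) A = wavelet_energy g f A"
  using wavelet_transform_diff_left[of g 0 f] wavelet_transform_diff_left[of g 0 0]
  by (simp add: wavelet_energy_def)

lemma wavelet_energy_add_Compl:
  assumes "admissible g" and [measurable]: "A \<in> sets borel"
  shows "wavelet_energy g f A + wavelet_energy g f (- A) = ennreal ((norm f)\<^sup>2)"
proof -
  have [measurable]: "- A \<in> sets borel" by (rule borel_comp) fact
  have "wavelet_energy g f A + wavelet_energy g f (- A)
      = (\<integral>\<^sup>+p. ennreal ((cmod (wavelet_transform g f (fst p) (snd p)))\<^sup>2) * indicator A p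
        + ennreal ((cmod (wavelet_transform g f (fst p) (snd p)))\<^sup>2) * indicator (- A) p \<partial>haar_measure)"
    unfolding wavelet_energy_def by (rule nn_integral_add[symmetric]) measurable
  also have "\<dots> = (\<integral>\<^sup>+p. ennreal ((cmod (wavelet_transform g f (fst p) (snd p)))\<^sup>2) \<partial>haar_measure)"
    by (intro nn_integral_cong) (auto simp: indicator_def)
  finally show ?thesis
    by (simp add: wavelet_isometry[OF assms(1)])
qed

lemma wavelet_energy_le_norm:
  assumes "admissible g" "A \<in> sets borel"
  shows "wavelet_energy g f A \<le> ennreal ((norm f)\<^sup>2)"
  unfolding wavelet_energy_add_Compl[OF assms, symmetric] by simp

text \<open>
  The shift by \<open>1\<close> avoids a division by \<open>0\<close> at \<open>n = 0\<close>.
\<close>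
definition half_space_box :: "nat \<Rightarrow> ((real^'d::finite) \<times> real) set" where
  "half_space_box n = cball 0 (real n) \<times> {1 / (real n + 1) .. real n + 1}"

lemma compact_half_space_box: "compact (half_space_box n)"
  unfolding half_space_box_def by (intro compact_Times) auto

lemma half_space_box_subset: "half_space_box n \<subseteq> UNIV \<times> {0<..}"
  by (auto simp: half_space_box_def intro: less_le_trans[rotated])

lemma half_space_box_eventually:
  fixes p :: "(real^'d::finite) \<times> real"
  assumes "snd p > 0"
  shows "\<forall>\<^sub>F n in sequentially. p \<in> half_space_box n"
proof -
  obtain k where k: "real k > max (norm (fst p)) (max (1 / snd p) (snd p))"
    using reals_Archimedean2 by blast
  have "p \<in> half_space_box n" if "n \<ge> k" for n
  proof -
    have n: "real n > norm (fst p)" "real n > 1 / snd p" "real n > snd p"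
      using k that by linarith+
    have "1 \<le> (real n + 1) * snd p"
    proof -
      have "1 < real n * snd p" using n(2) assms by (simp add: field_simps)
      then show ?thesis using assms by (simp add: distrib_right)
    qed
    then show ?thesis
      using n by (cases p) (simp add: half_space_box_def divide_le_eq mult.commute)
  qed
  then show ?thesis
    by (auto simp: eventually_sequentially)
qed

lemma wavelet_energy_exhaustion:
  fixes f g :: "'d::finite L2"
  assumes "admissible g"
  shows "(\<lambda>n. wavelet_energy g f (- half_space_box n)) \<longlonglongrightarrow> 0"
proof -
  have B [measurable]: "- half_space_box n \<in> sets (borel :: ((real^'d) \<times> real) measure)" for n
    by (intro borel_comp borel_closed compact_imp_closed compact_half_space_box)
  have "(\<lambda>n. wavelet_energy g f (- half_space_box n))
      \<longlonglongrightarrow> (\<integral>\<^sup>+p. 0 \<partial>(haar_measure :: ((real^'d) \<times> real) measure))"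
    unfolding wavelet_energy_def
  proof (rule nn_integral_dominated_convergence)
    show "(\<integral>\<^sup>+p. ennreal ((cmod (wavelet_transform g f (fst p) (snd p)))\<^sup>2) \<partial>haar_measure) < \<infinity>"
      by (simp add: wavelet_isometry[OF assms])
    show "AE p in haar_measure. ennreal ((cmod (wavelet_transform g f (fst p) (snd p)))\<^sup>2)
        * indicator (- half_space_box n) p
        \<le> ennreal ((cmod (wavelet_transform g f (fst p) (snd p)))\<^sup>2)" for n
      by (auto simp: indicator_def)
    show "AE p in haar_measure. (\<lambda>n. ennreal ((cmod (wavelet_transform g f (fst p) (snd p)))\<^sup>2)
        * indicator (- half_space_box n) p) \<longlonglongrightarrow> 0"
    proof (rule AE_I2)
      fix p :: "(real^'d) \<times> real"
      show "(\<lambda>n. ennreal ((cmod (wavelet_transform g f (fst p) (snd p)))\<^sup>2)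
          * indicator (- half_space_box n) p) \<longlonglongrightarrow> 0"
      proof (cases "snd p > 0")
        case True
        show ?thesis
          by (rule tendsto_eventually) (use half_space_box_eventually[OF True] in \<open>eventually_elim, simp\<close>)
      qed (simp add: wavelet_transform_nonpos)
    qed
  qed measurable
  then show ?thesis
    by simp
qed

lemma ennreal_sqrt_le_iff:
  assumes "c \<ge> 0"
  shows "ennreal_sqrt a \<le> ennreal c \<longleftrightarrow> a \<le> ennreal (c\<^sup>2)"
proof (cases a)
  case (real r)
  then show ?thesis
    using assms by (simp add: ennreal_sqrt_def ennreal_le_iff real_sqrt_le_iff' sqrt_le_D real_le_lsqrt)
qed (simp add: ennreal_sqrt_def top_unique)

text \<open>
  Because of the quantifier over \<open>\<epsilon>\<close>, a strict bound on a supremum of square roots can be replaced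
  by weak bounds on the individual squares.
\<close>
lemma SUP_ennreal_sqrt_less_iff:
  "(\<forall>\<epsilon>::real. \<epsilon> > 0 \<longrightarrow> (\<exists>U. P U \<and> (SUP f\<in>S. ennreal_sqrt (E f U)) < ennreal \<epsilon>))
    \<longleftrightarrow> (\<forall>\<epsilon>::real. \<epsilon> > 0 \<longrightarrow> (\<exists>U. P U \<and> (\<forall>f\<in>S. E f U \<le> ennreal (\<epsilon>\<^sup>2))))" (is "?L \<longleftrightarrow> ?R")
proof
  assume L: ?L
  show ?R
  proof (intro allI impI)
    fix \<epsilon> :: real assume "\<epsilon> > 0"
    then obtain U where U: "P U" "(SUP f\<in>S. ennreal_sqrt (E f U)) < ennreal \<epsilon>"
      using L by blast
    have "E f U \<le> ennreal (\<epsilon>\<^sup>2)" if "f \<in> S" for f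
      using SUP_upper[OF that, of "\<lambda>f. ennreal_sqrt (E f U)"] U(2) \<open>\<epsilon> > 0\<close>
      by (simp flip: ennreal_sqrt_le_iff)
    with U(1) show "\<exists>U. P U \<and> (\<forall>f\<in>S. E f U \<le> ennreal (\<epsilon>\<^sup>2))" by blast
  qed
next
  assume R: ?R
  show ?L
  proof (intro allI impI)
    fix \<epsilon> :: real assume e: "\<epsilon> > 0"
    then obtain U where U: "P U" "\<And>f. f \<in> S \<Longrightarrow> E f U \<le> ennreal ((\<epsilon> / 2)\<^sup>2)"
      using R half_gt_zero by meson
    have "(SUP f\<in>S. ennreal_sqrt (E f U)) \<le> ennreal (\<epsilon> / 2)"
    proof (rule SUP_least)
      fix f assume "f \<in> S"
      then show "ennreal_sqrt (E f U) \<le> ennreal (\<epsilon> / 2)"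
        using U(2) e by (subst ennreal_sqrt_le_iff) auto
    qed
    also have "\<dots> < ennreal \<epsilon>"
      using e by (intro ennreal_lessI) auto
    finally show "\<exists>U. P U \<and> (SUP f\<in>S. ennreal_sqrt (E f U)) < ennreal \<epsilon>"
      using U(1) by blast
  qed
qed

section \<open>Compactness and uniformly small tails\<close>

lemma compact_obtains_finite_net:
  fixes S :: "'a::metric_space set"
  assumes "compact S" "e > 0"
  obtains k where "finite k" "k \<subseteq> S" "S \<subseteq> (\<Union>x\<in>k. ball x e)"
proof -
  have "\<exists>k. finite k \<and> k \<subseteq> S \<and> S \<subseteq> (\<Union>x\<in>k. ball x e)"
    by (rule seq_compact_imp_totally_bounded[THEN spec, THEN mp])
      (simp_all add: assms compact_imp_seq_compact)
  then show ?thesis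
    by (elim exE conjE) (rule that)
qed

lemma ennreal_two_plus_two:
  "a \<ge> 0 \<Longrightarrow> 2 * ennreal a + 2 * ennreal a = ennreal (4 * a)"
  by (simp add: ennreal_mult flip: distrib_right)

text \<open>
  A box that works for a finite net works for the whole set, since the isometry bounds the energy
  of the difference to the nearest point of the net.
\<close>
lemma compact_imp_small_wavelet_tails:
  fixes g :: "'d::finite L2"
  assumes adm: "admissible g" and S: "compact S" and e: "\<epsilon> > 0"
  shows "\<exists>U. compact U \<and> U \<subseteq> UNIV \<times> {0<..} \<and> (\<forall>f\<in>S. wavelet_energy g f (- U) \<le> ennreal (\<epsilon>\<^sup>2))"
proof -
  obtain k where k: "finite k" "k \<subseteq> S" "S \<subseteq> (\<Union>x\<in>k. ball x (\<epsilon> / 2))"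
    by (rule compact_obtains_finite_net[OF S half_gt_zero[OF e]])
  have "\<forall>f\<in>k. \<forall>\<^sub>F n in sequentially. wavelet_energy g f (- half_space_box n) < ennreal ((\<epsilon> / 2)\<^sup>2)"
    using e by (intro ballI order_tendstoD(2)[OF wavelet_energy_exhaustion[OF adm]]) simp
  then have "\<forall>\<^sub>F n in sequentially. \<forall>f\<in>k. wavelet_energy g f (- half_space_box n) < ennreal ((\<epsilon> / 2)\<^sup>2)"
    using k(1) by (simp add: eventually_ball_finite_distrib)
  then obtain n where n: "\<And>f. f \<in> k \<Longrightarrow> wavelet_energy g f (- half_space_box n) < ennreal ((\<epsilon> / 2)\<^sup>2)"
    by (auto simp: eventually_sequentially)
  have B: "- half_space_box n \<in> sets (borel :: ((real^'d) \<times> real) measure)"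
    by (intro borel_comp borel_closed compact_imp_closed compact_half_space_box)
  have "wavelet_energy g f (- half_space_box n) \<le> ennreal (\<epsilon>\<^sup>2)" if f: "f \<in> S" for f
  proof -
    obtain h where h: "h \<in> k" "dist h f < \<epsilon> / 2"
      using k(3) f by auto
    have "wavelet_energy g (f - h) (- half_space_box n) \<le> ennreal ((norm (f - h))\<^sup>2)"
      by (rule wavelet_energy_le_norm[OF adm B])
    also have "\<dots> \<le> ennreal ((\<epsilon> / 2)\<^sup>2)"
      using h by (intro ennreal_leI power_mono) (auto simp: dist_norm norm_minus_commute)
    finally have "2 * wavelet_energy g h (- half_space_box n)
        + 2 * wavelet_energy g (f - h) (- half_space_box n)
        \<le> 2 * ennreal ((\<epsilon> / 2)\<^sup>2) + 2 * ennreal ((\<epsilon> / 2)\<^sup>2)"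
      using n[OF h(1)] by (intro add_mono mult_left_mono) auto
    also have "\<dots> = ennreal (\<epsilon>\<^sup>2)"
      by (simp add: ennreal_two_plus_two power_divide)
    finally show ?thesis
      by (rule order_trans[OF wavelet_energy_le_diff[OF B]])
  qed
  then show ?thesis
    using compact_half_space_box half_space_box_subset by blast
qed

text \<open>
  Each inner product maps \<open>S\<close> into a disc of the complex plane, which is covered by finitely many
  small balls; the classes are the common refinement of the preimages.
\<close>
lemma finite_cover_close_cinner:
  fixes S :: "'d::finite L2 set"
  assumes "bounded S" "finite P" "\<delta> > 0"
  shows "\<exists>\<C>. finite \<C> \<and> S \<subseteq> \<Union>\<C> \<and> (\<forall>C\<in>\<C>. \<forall>f\<in>C. \<forall>h\<in>C. \<forall>q\<in>P. cmod (cinner_L2 f q - cinner_L2 h q) < \<delta>)"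
  using assms(2)
proof (induction P)
  case empty
  show ?case by (intro exI[of _ "{S}"]) auto
next
  case (insert q P)
  from insert.IH obtain \<C> where C: "finite \<C>" "S \<subseteq> \<Union>\<C>"
    "\<forall>C\<in>\<C>. \<forall>f\<in>C. \<forall>h\<in>C. \<forall>p\<in>P. cmod (cinner_L2 f p - cinner_L2 h p) < \<delta>"
    by (elim exE conjE)
  obtain B where B: "\<And>f. f \<in> S \<Longrightarrow> norm f \<le> B"
    using assms(1) by (auto simp: bounded_iff)
  obtain Z where Z: "finite Z" "Z \<subseteq> cball (0::complex) (B * norm q)"
      "cball 0 (B * norm q) \<subseteq> (\<Union>z\<in>Z. ball z (\<delta> / 2))"
    by (rule compact_obtains_finite_net[OF compact_cball[of "0::complex"
        "B * norm q"] half_gt_zero[OF assms(3)]])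
  define \<C>' where "\<C>' = (\<Union>C\<in>\<C>. (\<lambda>z. {f \<in> C. cinner_L2 f q \<in> ball z (\<delta> / 2)}) ` Z)"
  have cover: "S \<subseteq> \<Union>\<C>'"
  proof
    fix f assume f: "f \<in> S"
    then obtain C where "C \<in> \<C>" "f \<in> C" using C(2) by blast
    have "cmod (cinner_L2 f q) \<le> B * norm q"
      using norm_cinner_L2_le[of f q] mult_right_mono[OF B[OF f] norm_ge_zero[of q]] by linarith
    then obtain z where "z \<in> Z" "cinner_L2 f q \<in> ball z (\<delta> / 2)"
      using Z(3) by (auto simp del: mem_ball)
    then show "f \<in> \<Union>\<C>'"
      using \<open>C \<in> \<C>\<close> \<open>f \<in> C\<close> unfolding \<C>'_def by blast
  qed
  have close: "cmod (cinner_L2 f p - cinner_L2 h p) < \<delta>"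
    if "C' \<in> \<C>'" "f \<in> C'" "h \<in> C'" "p \<in> insert q P" for C' f h p
  proof -
    obtain C z where Cz: "C \<in> \<C>" "C' = {f \<in> C. cinner_L2 f q \<in> ball z (\<delta> / 2)}"
      using \<open>C' \<in> \<C>'\<close> unfolding \<C>'_def by blast
    show ?thesis
    proof (cases "p = q")
      case True
      have "dist z (cinner_L2 f q) < \<delta> / 2" "dist z (cinner_L2 h q) < \<delta> / 2"
        using that Cz by auto
      then have "dist (cinner_L2 f q) (cinner_L2 h q) < \<delta>"
        by (rule dist_triangle_half_r)
      then show ?thesis by (simp add: True dist_norm)
    next
      case False
      then show ?thesis using C(3) Cz that by blast
    qed
  qed
  have fin: "finite \<C>'"
    using C(1) Z(1) by (simp add: \<C>'_def)
  show ?case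
    by (intro exI[of _ \<C>'] conjI ballI fin cover close)
qed

lemma emeasure_haar_compact_finite:
  fixes U :: "((real^'d::finite) \<times> real) set"
  assumes U: "compact U" "U \<subseteq> UNIV \<times> {0<..}"
  shows "emeasure haar_measure U < \<infinity>"
proof -
  have [measurable]: "U \<in> sets borel"
    using U by (intro borel_closed compact_imp_closed)
  define w where "w p = 1 / snd p ^ (CARD('d) + 1)" for p :: "(real^'d) \<times> real"
  have "continuous_on U w"
    unfolding w_def using U(2) by (intro continuous_intros) auto
  then have "bounded (w ` U)"
    using U(1) by (intro compact_imp_bounded compact_continuous_image)
  then obtain B where "\<forall>r\<in>w ` U. norm r \<le> B"
    unfolding bounded_iff by (elim exE)
  then have B: "w p \<le> B" if "p \<in> U" for p
    using that by (simp add: abs_le_iff)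
  have "emeasure haar_measure U = (\<integral>\<^sup>+p. ennreal 1 * indicator U p \<partial>haar_measure)"
    by simp
  also have "\<dots> = (\<integral>\<^sup>+p. ennreal (1 / snd p ^ (CARD('d) + 1)) * indicator (UNIV \<times> {0<..} \<inter> U) p \<partial>lborel)"
    by (rule nn_integral_haar) auto
  also have "\<dots> \<le> (\<integral>\<^sup>+p. ennreal B * indicator U p \<partial>lborel)"
  proof (rule nn_integral_mono)
    fix p :: "(real^'d) \<times> real"
    show "ennreal (1 / snd p ^ (CARD('d) + 1)) * indicator (UNIV \<times> {0<..} \<inter> U) p
        \<le> ennreal B * indicator U p"
      using B[of p] by (auto simp: indicator_def w_def intro!: ennreal_leI)
  qed
  also have "\<dots> = ennreal B * emeasure lborel U"
    by (simp add: nn_integral_cmult_indicator)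
  also have "\<dots> < \<infinity>"
    using emeasure_compact_finite[OF U(1)] by (simp add: ennreal_mult_less_top)
  finally show ?thesis .
qed

lemma finite_net_wavelet_atom:
  fixes g :: "'d::finite L2"
  assumes U: "compact U" "U \<subseteq> UNIV \<times> {0<..}" and "\<delta> > 0"
  obtains P where "finite P" "\<And>p. p \<in> U \<Longrightarrow> \<exists>q\<in>P. norm (wavelet_atom g p - q) < \<delta>"
proof -
  have "compact (wavelet_atom g ` U)"
    by (rule compact_continuous_image[OF continuous_on_subset[OF continuous_on_wavelet_atom U(2)] U(1)])
  then obtain P where P: "finite P" "P \<subseteq> wavelet_atom g ` U" "wavelet_atom g ` U \<subseteq> (\<Union>q\<in>P. ball q \<delta>)"
    by (rule compact_obtains_finite_net[OF _ assms(3)])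
  have "\<exists>q\<in>P. norm (wavelet_atom g p - q) < \<delta>" if "p \<in> U" for p
  proof -
    have "wavelet_atom g p \<in> (\<Union>q\<in>P. ball q \<delta>)" using P(3) that by blast
    then show ?thesis by (auto simp: dist_norm norm_minus_commute)
  qed
  with P(1) show ?thesis by (rule that)
qed

text \<open>
  Two members of one class of the cover differ by at most \<open>e / 2\<close> in the energy inside \<open>U\<close>, because
  their inner products with all atoms of \<open>U\<close> are close, and by at most \<open>e / 2\<close> in the energy outside
  \<open>U\<close>, where both have little. Here energies are measured by their square roots.
\<close>
lemma small_wavelet_tails_imp_totally_bounded:
  fixes g :: "'d::finite L2"
  assumes adm: "admissible g" and "bounded S" and e: "e > 0"
    and U: "compact U" "U \<subseteq> UNIV \<times> {0<..}"
    and tail: "\<And>f. f \<in> S \<Longrightarrow> wavelet_energy g f (- U) \<le> ennreal ((e / 4)\<^sup>2)"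
  shows "\<exists>k. finite k \<and> S \<subseteq> (\<Union>x\<in>k. ball x e)"
proof -
  obtain B where B: "B > 0" "\<And>f. f \<in> S \<Longrightarrow> norm f \<le> B"
    using assms(2) by (auto simp: bounded_pos)
  have Um [measurable]: "U \<in> sets borel"
    using U(1) by (intro borel_closed compact_imp_closed)
  have Um': "- U \<in> sets borel"
    by (rule borel_comp[OF Um])
  obtain m where m: "emeasure haar_measure U = ennreal m" "m \<ge> 0"
    using emeasure_haar_compact_finite[OF U] by (cases "emeasure haar_measure U") auto
  \<comment> \<open>On \<open>U\<close> the transform of a difference will be at most \<open>(1 + 2 * B) * \<delta>\<close>: an error \<open>\<delta>\<close> from
    the inner products with the net and \<open>2 * B * \<delta>\<close> from the distance to the net. Adding \<open>1\<close> to
    \<open>sqrt m\<close> covers the case \<open>m = 0\<close>.\<close>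
  define \<delta> where "\<delta> = (e / 2) / ((1 + 2 * B) * (sqrt m + 1))"
  have d: "\<delta> > 0"
    using e B(1) m(2) by (simp add: \<delta>_def add_nonneg_pos)
  have small: "((1 + 2 * B) * \<delta>)\<^sup>2 * m \<le> (e / 2)\<^sup>2"
  proof -
    have "(1 + 2 * B) * \<delta> * sqrt m \<le> (1 + 2 * B) * \<delta> * (sqrt m + 1)"
      using d B(1) by simp
    also have "\<dots> = e / 2"
    proof -
      have "1 + 2 * B \<noteq> 0" "sqrt m + 1 \<noteq> 0"
        using B(1) real_sqrt_ge_zero[OF m(2)] by linarith+
      moreover have "x * ((e / 2) / (x * y)) * y = e / 2" if "x \<noteq> 0" "y \<noteq> 0" for x y :: real
        using that by simp
      ultimately show ?thesis
        unfolding \<delta>_def by blast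
    qed
    finally have "((1 + 2 * B) * \<delta> * sqrt m)\<^sup>2 \<le> (e / 2)\<^sup>2"
      using d B(1) m(2) by (intro power_mono) auto
    then show ?thesis
      using m(2) by (simp add: power_mult_distrib)
  qed
  obtain P where P: "finite P" "\<And>p. p \<in> U \<Longrightarrow> \<exists>q\<in>P. norm (wavelet_atom g p - q) < \<delta>"
    using finite_net_wavelet_atom[OF U d] by blast
  obtain \<C> where C: "finite \<C>" "S \<subseteq> \<Union>\<C>"
    "\<forall>C\<in>\<C>. \<forall>f\<in>C. \<forall>h\<in>C. \<forall>q\<in>P. cmod (cinner_L2 f q - cinner_L2 h q) < \<delta>"
    using finite_cover_close_cinner[OF assms(2) P(1) d] by (elim exE conjE)
  have close: "dist f h < e" if C': "C \<in> \<C>" and f: "f \<in> S" "f \<in> C" and h: "h \<in> S" "h \<in> C" for C f h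
  proof -
    have W: "cmod (wavelet_transform g (f - h) (fst p) (snd p)) \<le> (1 + 2 * B) * \<delta>" if p: "p \<in> U" for p
    proof -
      obtain q where q: "q \<in> P" "norm (wavelet_atom g p - q) < \<delta>"
        using P(2)[OF p] by blast
      have "wavelet_transform g (f - h) (fst p) (snd p)
          = cinner_L2 (f - h) (wavelet_atom g p - q) + (cinner_L2 f q - cinner_L2 h q)"
        by (simp add: wavelet_transform_def cinner_L2_diff_left cinner_L2_diff_right)
      then have "cmod (wavelet_transform g (f - h) (fst p) (snd p))
          \<le> cmod (cinner_L2 (f - h) (wavelet_atom g p - q)) + cmod (cinner_L2 f q - cinner_L2 h q)"
        by (simp only: norm_triangle_ineq)
      also have "\<dots> \<le> (2 * B) * \<delta> + \<delta>"
      proof (rule add_mono)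
        have "norm (f - h) \<le> 2 * B"
          using norm_triangle_ineq4[of f h] B(2)[OF f(1)] B(2)[OF h(1)] by linarith
        then have "norm (f - h) * norm (wavelet_atom g p - q) \<le> (2 * B) * \<delta>"
          using q(2) B(1) by (intro mult_mono) auto
        then show "cmod (cinner_L2 (f - h) (wavelet_atom g p - q)) \<le> (2 * B) * \<delta>"
          using norm_cinner_L2_le order_trans by blast
        show "cmod (cinner_L2 f q - cinner_L2 h q) \<le> \<delta>"
          using C(3)[rule_format, OF C' f(2) h(2) q(1)] by simp
      qed
      finally show ?thesis
        by (simp add: algebra_simps)
    qed
    have "wavelet_energy g (f - h) U \<le> (\<integral>\<^sup>+p. ennreal (((1 + 2 * B) * \<delta>)\<^sup>2) * indicator U p \<partial>haar_measure)"
      unfolding wavelet_energy_def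
    proof (rule nn_integral_mono)
      fix p
      show "ennreal ((cmod (wavelet_transform g (f - h) (fst p) (snd p)))\<^sup>2) * indicator U p
          \<le> ennreal (((1 + 2 * B) * \<delta>)\<^sup>2) * indicator U p"
        using W[of p] by (cases "p \<in> U") (auto intro!: ennreal_leI power_mono)
    qed
    also have "\<dots> = ennreal (((1 + 2 * B) * \<delta>)\<^sup>2 * m)"
      using m by (simp add: nn_integral_cmult_indicator ennreal_mult)
    also have "\<dots> \<le> ennreal ((e / 2)\<^sup>2)"
      by (rule ennreal_leI[OF small])
    finally have U_part: "wavelet_energy g (f - h) U \<le> ennreal ((e / 2)\<^sup>2)" .
    have "wavelet_energy g (f - h) (- U) \<le> 2 * wavelet_energy g f (- U) + 2 * wavelet_energy g (- h) (- U)"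
      using wavelet_energy_le_diff[OF Um', of g "f - h" f] by simp
    also have "\<dots> \<le> 2 * ennreal ((e / 4)\<^sup>2) + 2 * ennreal ((e / 4)\<^sup>2)"
      using tail f(1) h(1) by (intro add_mono mult_left_mono) (auto simp: wavelet_energy_minus)
    also have "\<dots> = ennreal ((e / 2)\<^sup>2)"
      by (simp add: ennreal_two_plus_two power_divide)
    finally have "ennreal ((norm (f - h))\<^sup>2) \<le> ennreal ((e / 2)\<^sup>2) + ennreal ((e / 2)\<^sup>2)"
      unfolding wavelet_energy_add_Compl[OF adm Um, symmetric] by (intro add_mono U_part)
    also have "\<dots> = ennreal (e\<^sup>2 / 2)"
      by (simp add: power_divide flip: ennreal_plus)
    finally have "(norm (f - h))\<^sup>2 \<le> e\<^sup>2 / 2"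
      by simp
    also have "\<dots> < e\<^sup>2"
      using e by simp
    finally show ?thesis
      using e by (simp add: dist_norm power_less_imp_less_base)
  qed
  define rep where "rep C = (SOME f. f \<in> C \<inter> S)" for C
  have "S \<subseteq> (\<Union>x\<in>rep ` \<C>. ball x e)"
  proof
    fix f assume f: "f \<in> S"
    then obtain C where CC: "C \<in> \<C>" "f \<in> C" using C(2) by blast
    have "f \<in> C \<inter> S"
      using f CC(2) by simp
    then have "rep C \<in> C \<inter> S"
      unfolding rep_def by (rule someI)
    then have "dist (rep C) f < e"
      by (intro close[OF CC(1) _ _ f CC(2)]) simp_all
    then show "f \<in> (\<Union>x\<in>rep ` \<C>. ball x e)"
      using CC(1) by auto
  qed
  then show ?thesis
    using C(1) by (intro exI[of _ "rep ` \<C>"]) simp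
qed

theorem theorem3:
  fixes g :: "'d::finite L2" and S :: "'d L2 set"
  assumes "admissible g" and "closed S" and "bounded S"
  shows "compact S \<longleftrightarrow>
    (\<forall>\<epsilon>::real. \<epsilon> > 0 \<longrightarrow>
      (\<exists>U :: ((real^'d) \<times> real) set. compact U \<and> U \<subseteq> UNIV \<times> {0<..} \<and>
        (SUP f\<in>S. ennreal_sqrt
           (\<integral>\<^sup>+ (x, s) \<in> (UNIV \<times> {0<..}) - U.
              ennreal ((cmod (wavelet_transform g f x s))\<^sup>2 / s ^ (CARD('d) + 1)) \<partial>lborel))
        < ennreal \<epsilon>))"
proof -
  have condition_iff: "(compact U \<and> U \<subseteq> UNIV \<times> {0<..} \<and>
      (SUP f\<in>S. ennreal_sqrt
         (\<integral>\<^sup>+ (x, s) \<in> (UNIV \<times> {0<..}) - U.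
            ennreal ((cmod (wavelet_transform g f x s))\<^sup>2 / s ^ (CARD('d) + 1)) \<partial>lborel)) < ennreal \<epsilon>)
    \<longleftrightarrow> (compact U \<and> U \<subseteq> UNIV \<times> {0<..}) \<and> (SUP f\<in>S. ennreal_sqrt (wavelet_energy g f (- U))) < ennreal \<epsilon>"
    for \<epsilon> :: real and U :: "((real^'d) \<times> real) set"
    by (auto simp only: wavelet_energy_Compl_eq)
  have "compact S \<longleftrightarrow> (\<forall>\<epsilon>::real. \<epsilon> > 0 \<longrightarrow> (\<exists>U. (compact U \<and> U \<subseteq> UNIV \<times> {0<..}) \<and>
      (\<forall>f\<in>S. wavelet_energy g f (- U) \<le> ennreal (\<epsilon>\<^sup>2))))" (is "_ \<longleftrightarrow> ?tails")
  proof
    assume "compact S"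
    then show ?tails
      using compact_imp_small_wavelet_tails[OF assms(1)] by (metis (no_types, lifting))
  next
    assume tails: ?tails
    have "\<exists>k. finite k \<and> S \<subseteq> (\<Union>x\<in>k. ball x e)" if "e > 0" for e
    proof -
      have "e / 4 > 0"
        using that by simp
      with tails obtain U where U: "compact U" "U \<subseteq> UNIV \<times> {0<..}"
        "\<forall>f\<in>S. wavelet_energy g f (- U) \<le> ennreal ((e / 4)\<^sup>2)"
        by blast
      show ?thesis
        by (rule small_wavelet_tails_imp_totally_bounded[OF assms(1,3) that U(1,2) U(3)[rule_format]])
    qed
    moreover have "complete S"
      using complete_closed_subset[OF assms(2) subset_UNIV complete_L2] .
    ultimately show "compact S"
      by (simp add: compact_eq_totally_bounded)
  qed
  then show ?thesis
    unfolding condition_iff SUP_ennreal_sqrt_less_iff .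
qed

end
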